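(* Let $(X,b)$ be a connected symmetric weighted graph with weight $\mu\colon X\to(0,\infty)$, and assume that $(X,b,\mu)$ satisfies the finiteness condition (FC), i.e. for every $x\in X$ the function $y\mapsto b(x,y)/\mu(y)$ belongs to $\ell^2_\mu(X)$. Assume that there exists an intrinsic pseudo metric $\rho$ for $(X,b,\mu)$ such that the following two conditions hold: (B* ) for every $o\in X$ and every $r\geq 0$ the weighted vertex degree $\operatorname{Deg}$ is bounded on the ball $B(o,r)=\{y\in X\colon\rho(o,y)\leq r\}$; (J) the jump size $s=\sup\{\rho(x,y)\colon x,y\in X,\ x\sim y\}$ is finite. Let $V\colon X\to\mathbb{R}$ be such that there exist $o\in X$ and constants $b_1\geq 0$ and $b_2\geq 0$ with $$V(x)\geq -b_1-b_2[\rho(o,x)]^2\quad\text{for all }x\in X.$$ Then the operator $\mathcal{L}_V|_{C_c(X)}$ is essentially self-adjoint in $\ell^2_\mu(X)$.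
   Context: A symmetric weighted graph $(X,b)$ consists of a countable nonempty set $X$ (vertices) and a function $b\colon X\times X\to[0,\infty)$ with $b(x,y)=b(y,x)$ for all $x,y\in X$, $b(x,x)=0$ for all $x\in X$, and $\sum_{z\in X}b(x,z)<\infty$ for all $x\in X$. The graph is not assumed to be locally finite. Write $x\sim y$ if $b(x,y)>0$. The graph is connected if any two vertices $x,y$ can be joined by a finite path, i.e. a finite sequence of vertices $x=x_0,x_1,\dots,x_n=y$ with $x_j\sim x_{j+1}$ for $0\leq j\leq n-1$. $C(X)$ is the set of all functions $f\colon X\to\mathbb{C}$ and $C_c(X)$ is the set of finitely supported functions in $C(X)$. For a weight $\mu\colon X\to(0,\infty)$, $\ell^2_\mu(X)$ is the Hilbert space of $f\in C(X)$ with $\sum_{x\in X}\mu(x)|f(x)|^2<\infty$, with inner product $(f,g)=\sum_{x\in X}\mu(x)f(x)\overline{g(x)}$. Weighted vertex degree: $\operatorname{Deg}(x)=\frac{1}{\mu(x)}\sum_{y\in X}b(x,y)$. A pseudo metric is a symmetric map $\rho\colon X\times X\to[0,\infty)$ with $\rho(x,x)=0$ for all $x\in X$ that satisfies the triangle inequality. It is called intrinsic for $(X,b,\mu)$ if $\sum_{y\in X}b(x,y)(\rho(x,y))^2\leq\mu(x)$ for all $x\in X$. For $V\colon X\to\mathbb{R}$, the formal discrete Schrödinger operator $\mathcal{L}_V\colon\mathcal{F}\to C(X)$ has domain $\mathcal{F}=\{f\in C(X)\colon \sum_{y\in X}b(x,y)|f(y)|<\infty\text{ for all }x\in X\}$ and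 acts by $$\mathcal{L}_Vf(x)=\frac{1}{\mu(x)}\sum_{y\in X}b(x,y)(f(x)-f(y))+V(x)f(x),\quad x\in X.$$ Condition (FC) is equivalent to $\mathcal{L}_V[C_c(X)]\subseteq\ell^2_\mu(X)$, so under (FC) the restriction $\mathcal{L}_V|_{C_c(X)}$ is regarded as an operator in $\ell^2_\mu(X)$ with domain $C_c(X)$; it is symmetric. *)

theory Defs
  imports "HOL-Analysis.Analysis"
begin

text \<open>
  The vertex set is the universe of a type of class \<open>countable\<close>, hence nonempty and
  finite or countably infinite.
\<close>

definition weighted_graph :: "('v::countable \<Rightarrow> 'v \<Rightarrow> real) \<Rightarrow> bool" where
  "weighted_graph b \<longleftrightarrow>
     (\<forall>x y. 0 \<le> b x y) \<and> (\<forall>x y. b x y = b y x) \<and> (\<forall>x. b x x = 0) \<and>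
     (\<forall>x. (\<lambda>z. b x z) summable_on UNIV)"

definition adjacent :: "('v \<Rightarrow> 'v \<Rightarrow> real) \<Rightarrow> 'v \<Rightarrow> 'v \<Rightarrow> bool" where
  "adjacent b x y \<longleftrightarrow> b x y > 0"

definition connected_graph :: "('v \<Rightarrow> 'v \<Rightarrow> real) \<Rightarrow> bool" where
  "connected_graph b \<longleftrightarrow> (\<forall>x y. (adjacent b)\<^sup>*\<^sup>* x y)"

definition weighted_degree :: "('v \<Rightarrow> 'v \<Rightarrow> real) \<Rightarrow> ('v \<Rightarrow> real) \<Rightarrow> 'v \<Rightarrow> real" where
  "weighted_degree b \<mu> x = (1 / \<mu> x) * (\<Sum>\<^sub>\<infinity>y. b x y)"


definition pseudo_metric :: "('v \<Rightarrow> 'v \<Rightarrow> real) \<Rightarrow> bool" where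
  "pseudo_metric \<rho> \<longleftrightarrow>
     (\<forall>x y. 0 \<le> \<rho> x y) \<and> (\<forall>x y. \<rho> x y = \<rho> y x) \<and> (\<forall>x. \<rho> x x = 0) \<and>
     (\<forall>x y z. \<rho> x z \<le> \<rho> x y + \<rho> y z)"

text \<open>
  Summability is required separately because \<open>infsum\<close> is \<open>0\<close> on non-summable families.
\<close>

definition intrinsic ::
  "('v \<Rightarrow> 'v \<Rightarrow> real) \<Rightarrow> ('v \<Rightarrow> real) \<Rightarrow> ('v \<Rightarrow> 'v \<Rightarrow> real) \<Rightarrow> bool" where
  "intrinsic b \<mu> \<rho> \<longleftrightarrow>
     (\<forall>x. (\<lambda>y. b x y * (\<rho> x y)\<^sup>2) summable_on UNIV \<and>
          (\<Sum>\<^sub>\<infinity>y. b x y * (\<rho> x y)\<^sup>2) \<le> \<mu> x)"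

definition pm_ball :: "('v \<Rightarrow> 'v \<Rightarrow> real) \<Rightarrow> 'v \<Rightarrow> real \<Rightarrow> 'v set" where
  "pm_ball \<rho> p r = {y. \<rho> p y \<le> r}"

text \<open>
  The supremum is taken in \<open>[0, \<infinity>]\<close>, so that it is \<open>0\<close> for a graph without edges.
\<close>

definition jump_size :: "('v \<Rightarrow> 'v \<Rightarrow> real) \<Rightarrow> ('v \<Rightarrow> 'v \<Rightarrow> real) \<Rightarrow> ennreal" where
  "jump_size b \<rho> = Sup {ennreal (\<rho> x y) | x y. adjacent b x y}"


definition ell2 :: "('v \<Rightarrow> real) \<Rightarrow> ('v \<Rightarrow> complex) set" where
  "ell2 \<mu> = {f. (\<lambda>x. \<mu> x * (cmod (f x))\<^sup>2) summable_on UNIV}"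

definition ell2_inner :: "('v \<Rightarrow> real) \<Rightarrow> ('v \<Rightarrow> complex) \<Rightarrow> ('v \<Rightarrow> complex) \<Rightarrow> complex" where
  "ell2_inner \<mu> f g = (\<Sum>\<^sub>\<infinity>x. of_real (\<mu> x) * f x * cnj (g x))"

definition ell2_norm :: "('v \<Rightarrow> real) \<Rightarrow> ('v \<Rightarrow> complex) \<Rightarrow> real" where
  "ell2_norm \<mu> f = sqrt (\<Sum>\<^sub>\<infinity>x. \<mu> x * (cmod (f x))\<^sup>2)"

definition finiteness_condition :: "('v \<Rightarrow> 'v \<Rightarrow> real) \<Rightarrow> ('v \<Rightarrow> real) \<Rightarrow> bool" where
  "finiteness_condition b \<mu> \<longleftrightarrow> (\<forall>x. (\<lambda>y. of_real (b x y / \<mu> y)) \<in> ell2 \<mu>)"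


text \<open>
  A (possibly unbounded) operator is identified with its graph, a set of pairs \<open>(f, A f)\<close>;
  its domain is \<open>Domain A\<close>.
\<close>

type_synonym 'v operator = "(('v \<Rightarrow> complex) \<times> ('v \<Rightarrow> complex)) set"

definition restrict_operator :: "'v operator \<Rightarrow> ('v \<Rightarrow> complex) set \<Rightarrow> 'v operator" where
  "restrict_operator A D = {(f, g) \<in> A. f \<in> D}"

definition ell2_operator :: "('v \<Rightarrow> real) \<Rightarrow> 'v operator \<Rightarrow> bool" where
  "ell2_operator \<mu> A \<longleftrightarrow>
     A \<subseteq> ell2 \<mu> \<times> ell2 \<mu> \<and> single_valued A \<and>
     ((\<lambda>x. 0), (\<lambda>x. 0)) \<in> A \<and>
     (\<forall>f u g v. (f, u) \<in> A \<longrightarrow> (g, v) \<in> A \<longrightarrow> ((\<lambda>x. f x + g x), (\<lambda>x. u x + v x)) \<in> A) \<and>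
     (\<forall>c f u. (f, u) \<in> A \<longrightarrow> ((\<lambda>x. c * f x), (\<lambda>x. c * u x)) \<in> A)"

definition densely_defined :: "('v \<Rightarrow> real) \<Rightarrow> 'v operator \<Rightarrow> bool" where
  "densely_defined \<mu> A \<longleftrightarrow>
     (\<forall>f \<in> ell2 \<mu>. \<forall>\<epsilon>>0. \<exists>g \<in> Domain A. ell2_norm \<mu> (\<lambda>x. f x - g x) < \<epsilon>)"

definition symmetric_operator :: "('v \<Rightarrow> real) \<Rightarrow> 'v operator \<Rightarrow> bool" where
  "symmetric_operator \<mu> A \<longleftrightarrow>
     (\<forall>(f, u) \<in> A. \<forall>(g, v) \<in> A. ell2_inner \<mu> u g = ell2_inner \<mu> f v)"

definition operator_adjoint :: "('v \<Rightarrow> real) \<Rightarrow> 'v operator \<Rightarrow> 'v operator" where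
  "operator_adjoint \<mu> A =
     {(g, h) \<in> ell2 \<mu> \<times> ell2 \<mu>. \<forall>(f, u) \<in> A. ell2_inner \<mu> u g = ell2_inner \<mu> f h}"

definition operator_closure :: "('v \<Rightarrow> real) \<Rightarrow> 'v operator \<Rightarrow> 'v operator" where
  "operator_closure \<mu> A =
     {(f, u) \<in> ell2 \<mu> \<times> ell2 \<mu>. \<forall>\<epsilon>>0. \<exists>(g, v) \<in> A.
        ell2_norm \<mu> (\<lambda>x. f x - g x) < \<epsilon> \<and> ell2_norm \<mu> (\<lambda>x. u x - v x) < \<epsilon>}"

definition self_adjoint :: "('v \<Rightarrow> real) \<Rightarrow> 'v operator \<Rightarrow> bool" where
  "self_adjoint \<mu> A \<longleftrightarrow>
     ell2_operator \<mu> A \<and> densely_defined \<mu> A \<and> operator_adjoint \<mu> A = A"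

definition essentially_self_adjoint :: "('v \<Rightarrow> real) \<Rightarrow> 'v operator \<Rightarrow> bool" where
  "essentially_self_adjoint \<mu> A \<longleftrightarrow>
     ell2_operator \<mu> A \<and> densely_defined \<mu> A \<and> symmetric_operator \<mu> A \<and>
     self_adjoint \<mu> (operator_closure \<mu> A)"


definition finitely_supported :: "('v \<Rightarrow> complex) set" where
  "finitely_supported = {f. finite {x. f x \<noteq> 0}}"

definition formal_domain :: "('v \<Rightarrow> 'v \<Rightarrow> real) \<Rightarrow> ('v \<Rightarrow> complex) set" where
  "formal_domain b = {f. \<forall>x. (\<lambda>y. b x y * cmod (f y)) summable_on UNIV}"

definition schroedinger ::
  "('v \<Rightarrow> 'v \<Rightarrow> real) \<Rightarrow> ('v \<Rightarrow> real) \<Rightarrow> ('v \<Rightarrow> real) \<Rightarrow> 'v operator" where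
  "schroedinger b \<mu> V =
     {(f, \<lambda>x. of_real (1 / \<mu> x) * (\<Sum>\<^sub>\<infinity>y. of_real (b x y) * (f x - f y)) + of_real (V x) * f x)
      | f. f \<in> formal_domain b}"

end

theory Submission
  imports Defs
begin

text \<open>
  By von Neumann's criterion it suffices that the adjoint of the minimal operator has neither \<open>\<i>\<close> nor
  \<open>- \<i>\<close> as an eigenvalue. Green's formula shows that the adjoint acts as the formal operator, so the
  claim becomes: a function \<open>w\<close> in \<open>ell2\<close> that solves the eigenvalue equation for a nonreal \<open>\<zeta>\<close>
  vanishes.

  Let \<open>\<phi>\<close> be a cutoff function that is 1 on the ball of radius \<open>n\<close> about \<open>p\<close>, supported in the ball of
  radius \<open>2 n\<close> and Lipschitz with constant \<open>1 / n\<close>. Multiply the equation at \<open>x\<close> by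
  \<open>\<mu> x (\<phi> x)\<^sup>2\<close> and the conjugate of \<open>w x\<close>, sum over \<open>x\<close>, and symmetrise the resulting double series
  over edges. The boundedness of the degree on balls and the finite jump size make all series
  absolutely convergent. The result is one complex identity between
  \<open>\<Sum>\<^sub>x \<mu> (\<zeta> - V) \<phi>\<^sup>2 |w|\<^sup>2\<close>, the energy
  \<open>E = \<Sum>\<^sub>x\<^sub>,\<^sub>y b x y ((\<phi> x)\<^sup>2 + (\<phi> y)\<^sup>2) |w x - w y|\<^sup>2\<close>, and a cross term in which every summand has
  the factor \<open>\<phi> x - \<phi> y\<close>. Because the metric is intrinsic, the cross term is bounded by
  \<open>t E + 2 \<tau> / (t n\<^sup>2)\<close> for every \<open>t > 0\<close>, where \<open>\<tau>\<close> is the mass of \<open>w\<close> at distance at least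
  \<open>n - s\<close> from \<open>p\<close> and \<open>s\<close> bounds the jump size.

  The real part of the identity, with the quadratic lower bound of \<open>V\<close>, gives \<open>E \<le> C n\<^sup>2\<close>
  (\<open>Caccioppoli\<close>). The imaginary part, with \<open>t = \<delta> / n\<^sup>2\<close>, gives
  \<open>4 |Im \<zeta>| \<Sum>\<^sub>x \<mu> \<phi>\<^sup>2 |w|\<^sup>2 \<le> \<delta> C + 2 \<tau> / \<delta>\<close> (\<open>cutoff_mass_le\<close>). Since \<open>\<tau>\<close> tends to 0 as \<open>n\<close> grows
  and \<open>\<delta>\<close> is arbitrary, \<open>w = 0\<close> (\<open>nonreal_eigenfunction_zero\<close>). It matters that only first
  differences of \<open>\<phi>\<close> occur: an intrinsic metric gives no uniform bound for the Laplacian of \<open>\<phi>\<close> when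
  the degree is unbounded, so estimating the formal operator on \<open>\<phi> w\<close> directly is not an option.
\<close>

section \<open>The Hilbert space of square summable functions\<close>

lemma norm_add_square_le:
  fixes u v :: "'a::real_normed_vector"
  shows "(norm (u + v))\<^sup>2 \<le> 2 * (norm u)\<^sup>2 + 2 * (norm v)\<^sup>2"
proof -
  have "(norm (u + v))\<^sup>2 \<le> (norm u + norm v)\<^sup>2"
    by (intro power_mono norm_triangle_ineq norm_ge_zero)
  also have "\<dots> \<le> 2 * (norm u)\<^sup>2 + 2 * (norm v)\<^sup>2"
    using sum_squares_bound[of "norm u" "norm v"] by (simp add: power2_sum)
  finally show ?thesis .
qed

context
  fixes \<mu> :: "'a \<Rightarrow> real"
  assumes weight_pos: "\<And>x. 0 < \<mu> x"
begin

lemma weight_nonneg: "0 \<le> \<mu> x"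
  using weight_pos[of x] by simp

lemma ell2_scale:
  assumes "f \<in> ell2 \<mu>"
  shows "(\<lambda>x. c * f x) \<in> ell2 \<mu>"
proof -
  have "(\<lambda>x. (cmod c)\<^sup>2 * (\<mu> x * (cmod (f x))\<^sup>2)) summable_on UNIV"
    using assms by (intro summable_on_cmult_right) (simp add: ell2_def)
  then show ?thesis
    by (simp add: ell2_def norm_mult power_mult_distrib mult_ac)
qed

lemma ell2_add:
  assumes "f \<in> ell2 \<mu>" "g \<in> ell2 \<mu>"
  shows "(\<lambda>x. f x + g x) \<in> ell2 \<mu>"
proof -
  have "(\<lambda>x. 2 * (\<mu> x * (cmod (f x))\<^sup>2) + 2 * (\<mu> x * (cmod (g x))\<^sup>2)) summable_on UNIV"
    using assms by (intro summable_on_add summable_on_cmult_right) (simp_all add: ell2_def)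
  then have "(\<lambda>x. \<mu> x * (cmod (f x + g x))\<^sup>2) summable_on UNIV"
  proof (rule summable_on_comparison_test)
    fix x
    have "\<mu> x * (cmod (f x + g x))\<^sup>2 \<le> \<mu> x * (2 * (cmod (f x))\<^sup>2 + 2 * (cmod (g x))\<^sup>2)"
      by (intro mult_left_mono norm_add_square_le weight_nonneg)
    then show "\<mu> x * (cmod (f x + g x))\<^sup>2 \<le> 2 * (\<mu> x * (cmod (f x))\<^sup>2) + 2 * (\<mu> x * (cmod (g x))\<^sup>2)"
      by (simp add: algebra_simps)
  qed (simp add: weight_nonneg)
  then show ?thesis
    by (simp add: ell2_def)
qed

lemma ell2_zero: "(\<lambda>x. 0) \<in> ell2 \<mu>"
  by (simp add: ell2_def)

lemma ell2_diff:
  assumes "f \<in> ell2 \<mu>" "g \<in> ell2 \<mu>"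
  shows "(\<lambda>x. f x - g x) \<in> ell2 \<mu>"
  using ell2_add[OF assms(1) ell2_scale[OF assms(2), of "-1"]] by simp

lemma ell2_sum:
  assumes "finite S" "\<And>y. y \<in> S \<Longrightarrow> F y \<in> ell2 \<mu>"
  shows "(\<lambda>x. \<Sum>y\<in>S. F y x) \<in> ell2 \<mu>"
  using assms by (induction S rule: finite_induct) (auto intro: ell2_zero ell2_add)

lemma finitely_supported_subset_ell2: "finitely_supported \<subseteq> ell2 \<mu>"
proof
  fix f :: "'a \<Rightarrow> complex" assume "f \<in> finitely_supported"
  then show "f \<in> ell2 \<mu>"
    unfolding finitely_supported_def ell2_def
    by (auto intro!: finite_nonzero_values_imp_summable_on elim: rev_finite_subset)
qed

lemma ell2_norm_nonneg: "0 \<le> ell2_norm \<mu> f"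
  by (simp add: ell2_norm_def infsum_nonneg weight_nonneg)

lemma ell2_norm_square: "(ell2_norm \<mu> f)\<^sup>2 = (\<Sum>\<^sub>\<infinity>x. \<mu> x * (cmod (f x))\<^sup>2)"
  by (simp add: ell2_norm_def infsum_nonneg weight_nonneg)

lemma ell2_finite_sum_le_norm:
  assumes "f \<in> ell2 \<mu>" "finite S"
  shows "(\<Sum>x\<in>S. \<mu> x * (cmod (f x))\<^sup>2) \<le> (ell2_norm \<mu> f)\<^sup>2"
  unfolding ell2_norm_square
  using assms by (intro finite_sum_le_infsum) (auto simp: ell2_def weight_nonneg)

text \<open>
  The norm is controlled by finite partial sums. This replaces Fatou's lemma in the proof of
  completeness: bounds on finite sums survive pointwise limits.
\<close>
lemma ell2_norm_le_iff_finite_sums: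
  assumes "0 \<le> r"
  shows "(f \<in> ell2 \<mu> \<and> ell2_norm \<mu> f \<le> r) \<longleftrightarrow>
    (\<forall>S. finite S \<longrightarrow> (\<Sum>x\<in>S. \<mu> x * (cmod (f x))\<^sup>2) \<le> r\<^sup>2)" (is "?L \<longleftrightarrow> ?R")
proof
  assume ?L
  then show ?R
    using ell2_finite_sum_le_norm[of f] ell2_norm_nonneg[of f]
    by (meson order_trans power_mono)
next
  assume R: ?R
  have "(\<lambda>x. \<mu> x * (cmod (f x))\<^sup>2) summable_on UNIV"
    using R by (intro nonneg_bdd_above_summable_on bdd_aboveI2[where M = "r\<^sup>2"])
      (auto simp: weight_nonneg)
  moreover from this have "(ell2_norm \<mu> f)\<^sup>2 \<le> r\<^sup>2"
    unfolding ell2_norm_square using R by (intro infsum_le_finite_sums) auto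
  ultimately show ?L
    using power2_le_imp_le[of "ell2_norm \<mu> f" r] assms by (simp add: ell2_def)
qed

lemma finite_sum_Cauchy_Schwarz:
  assumes "f \<in> ell2 \<mu>" "g \<in> ell2 \<mu>" "finite S"
  shows "(\<Sum>x\<in>S. cmod (of_real (\<mu> x) * f x * cnj (g x))) \<le> ell2_norm \<mu> f * ell2_norm \<mu> g"
proof -
  have L2: "L2_set (\<lambda>x. sqrt (\<mu> x) * cmod (h x)) S \<le> ell2_norm \<mu> h" if "h \<in> ell2 \<mu>" for h
    using ell2_finite_sum_le_norm[OF that assms(3)] ell2_norm_nonneg[of h]
    unfolding L2_set_def by (intro real_le_lsqrt) (simp_all add: power_mult_distrib weight_nonneg sum_nonneg)
  have "(\<Sum>x\<in>S. cmod (of_real (\<mu> x) * f x * cnj (g x))) =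
      (\<Sum>x\<in>S. \<bar>sqrt (\<mu> x) * cmod (f x)\<bar> * \<bar>sqrt (\<mu> x) * cmod (g x)\<bar>)"
  proof (intro sum.cong refl)
    fix x
    have "\<mu> x = sqrt (\<mu> x) * sqrt (\<mu> x)"
      by (simp add: weight_nonneg)
    then show "cmod (of_real (\<mu> x) * f x * cnj (g x)) =
        \<bar>sqrt (\<mu> x) * cmod (f x)\<bar> * \<bar>sqrt (\<mu> x) * cmod (g x)\<bar>"
      using weight_nonneg[of x] by (simp add: norm_mult abs_mult)
  qed
  also have "\<dots> \<le> L2_set (\<lambda>x. sqrt (\<mu> x) * cmod (f x)) S * L2_set (\<lambda>x. sqrt (\<mu> x) * cmod (g x)) S"
    by (rule L2_set_mult_ineq)
  also have "\<dots> \<le> ell2_norm \<mu> f * ell2_norm \<mu> g"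
    using assms by (intro mult_mono L2 ell2_norm_nonneg L2_set_nonneg)
  finally show ?thesis .
qed

lemma ell2_inner_abs_summable:
  assumes "f \<in> ell2 \<mu>" "g \<in> ell2 \<mu>"
  shows "(\<lambda>x. cmod (of_real (\<mu> x) * f x * cnj (g x))) summable_on UNIV"
  using finite_sum_Cauchy_Schwarz[OF assms]
  by (intro nonneg_bdd_above_summable_on bdd_aboveI2) auto

lemmas ell2_inner_summable = abs_summable_summable[OF ell2_inner_abs_summable]

lemma ell2_Cauchy_Schwarz:
  assumes "f \<in> ell2 \<mu>" "g \<in> ell2 \<mu>"
  shows "cmod (ell2_inner \<mu> f g) \<le> ell2_norm \<mu> f * ell2_norm \<mu> g"
proof -
  have "cmod (ell2_inner \<mu> f g) \<le> (\<Sum>\<^sub>\<infinity>x. cmod (of_real (\<mu> x) * f x * cnj (g x)))"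
    unfolding ell2_inner_def by (intro norm_infsum_bound ell2_inner_abs_summable assms)
  also have "\<dots> \<le> ell2_norm \<mu> f * ell2_norm \<mu> g"
    by (intro infsum_le_finite_sums ell2_inner_abs_summable finite_sum_Cauchy_Schwarz assms)
  finally show ?thesis .
qed

lemma ell2_inner_cnj: "cnj (ell2_inner \<mu> f g) = ell2_inner \<mu> g f"
  unfolding ell2_inner_def infsum_cnj[symmetric] by (simp add: mult_ac)

lemma ell2_inner_scale_left: "ell2_inner \<mu> (\<lambda>x. c * f x) g = c * ell2_inner \<mu> f g"
  unfolding ell2_inner_def infsum_cmult_right'[symmetric] by (simp add: mult_ac)

lemma ell2_inner_scale_right: "ell2_inner \<mu> f (\<lambda>x. c * g x) = cnj c * ell2_inner \<mu> f g"
  unfolding ell2_inner_def infsum_cmult_right'[symmetric] by (simp add: mult_ac)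

lemma ell2_inner_add_left:
  assumes "f \<in> ell2 \<mu>" "g \<in> ell2 \<mu>" "h \<in> ell2 \<mu>"
  shows "ell2_inner \<mu> (\<lambda>x. f x + g x) h = ell2_inner \<mu> f h + ell2_inner \<mu> g h"
  unfolding ell2_inner_def
  using infsum_add[OF ell2_inner_summable[OF assms(1,3)] ell2_inner_summable[OF assms(2,3)]]
  by (simp add: algebra_simps)

lemma ell2_inner_add_right:
  assumes "f \<in> ell2 \<mu>" "g \<in> ell2 \<mu>" "h \<in> ell2 \<mu>"
  shows "ell2_inner \<mu> h (\<lambda>x. f x + g x) = ell2_inner \<mu> h f + ell2_inner \<mu> h g"
  using arg_cong[OF ell2_inner_add_left[OF assms], of cnj] by (simp add: ell2_inner_cnj)

lemma ell2_inner_diff_left: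
  assumes "f \<in> ell2 \<mu>" "g \<in> ell2 \<mu>" "h \<in> ell2 \<mu>"
  shows "ell2_inner \<mu> (\<lambda>x. f x - g x) h = ell2_inner \<mu> f h - ell2_inner \<mu> g h"
  using ell2_inner_add_left[OF assms(1) ell2_scale[OF assms(2), of "-1"] assms(3)]
    ell2_inner_scale_left[of "-1" g h] by simp

lemma ell2_inner_diff_right:
  assumes "f \<in> ell2 \<mu>" "g \<in> ell2 \<mu>" "h \<in> ell2 \<mu>"
  shows "ell2_inner \<mu> h (\<lambda>x. f x - g x) = ell2_inner \<mu> h f - ell2_inner \<mu> h g"
  using arg_cong[OF ell2_inner_diff_left[OF assms], of cnj] by (simp add: ell2_inner_cnj)

lemma ell2_inner_self:
  assumes "f \<in> ell2 \<mu>"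
  shows "ell2_inner \<mu> f f = of_real ((ell2_norm \<mu> f)\<^sup>2)"
proof -
  have "((\<lambda>x. complex_of_real (\<mu> x * (cmod (f x))\<^sup>2)) has_sum
      of_real ((ell2_norm \<mu> f)\<^sup>2)) UNIV"
    unfolding ell2_norm_square using assms
    by (intro has_sum_of_real has_sum_infsum) (simp add: ell2_def)
  moreover have "complex_of_real (\<mu> x * (cmod (f x))\<^sup>2) = of_real (\<mu> x) * f x * cnj (f x)" for x
    unfolding of_real_mult complex_norm_square by (simp add: mult_ac)
  ultimately show ?thesis
    unfolding ell2_inner_def by (intro infsumI) (simp only:)
qed

lemma ell2_norm_scale: "ell2_norm \<mu> (\<lambda>x. c * f x) = cmod c * ell2_norm \<mu> f"
proof -
  have "(\<Sum>\<^sub>\<infinity>x. \<mu> x * (cmod (c * f x))\<^sup>2) = (cmod c)\<^sup>2 * (\<Sum>\<^sub>\<infinity>x. \<mu> x * (cmod (f x))\<^sup>2)"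
    unfolding infsum_cmult_right'[symmetric] by (simp add: norm_mult power_mult_distrib mult_ac)
  then show ?thesis
    by (simp add: ell2_norm_def real_sqrt_mult)
qed

lemma ell2_norm_add_square:
  assumes "f \<in> ell2 \<mu>" "g \<in> ell2 \<mu>"
  shows "(ell2_norm \<mu> (\<lambda>x. f x + g x))\<^sup>2 =
    (ell2_norm \<mu> f)\<^sup>2 + 2 * Re (ell2_inner \<mu> f g) + (ell2_norm \<mu> g)\<^sup>2"
proof -
  have "complex_of_real ((ell2_norm \<mu> (\<lambda>x. f x + g x))\<^sup>2) =
      ell2_inner \<mu> f f + ell2_inner \<mu> f g + (cnj (ell2_inner \<mu> f g) + ell2_inner \<mu> g g)"
    using assms
    unfolding ell2_inner_cnj ell2_inner_self[OF ell2_add[OF assms], symmetric]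
    by (simp add: ell2_add ell2_inner_add_left ell2_inner_add_right)
  then have "Re (complex_of_real ((ell2_norm \<mu> (\<lambda>x. f x + g x))\<^sup>2)) =
      Re (ell2_inner \<mu> f f + ell2_inner \<mu> f g + (cnj (ell2_inner \<mu> f g) + ell2_inner \<mu> g g))"
    by (rule arg_cong)
  then show ?thesis
    unfolding ell2_inner_self[OF assms(1)] ell2_inner_self[OF assms(2)] by simp
qed

lemma ell2_norm_diff_square:
  assumes "f \<in> ell2 \<mu>" "g \<in> ell2 \<mu>"
  shows "(ell2_norm \<mu> (\<lambda>x. f x - g x))\<^sup>2 =
    (ell2_norm \<mu> f)\<^sup>2 - 2 * Re (ell2_inner \<mu> f g) + (ell2_norm \<mu> g)\<^sup>2"
  using ell2_norm_add_square[OF assms(1) ell2_scale[OF assms(2), of "-1"]]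
    ell2_inner_scale_right[of f "-1" g] ell2_norm_scale[of "-1" g] by simp

lemma ell2_norm_triangle:
  assumes "f \<in> ell2 \<mu>" "g \<in> ell2 \<mu>"
  shows "ell2_norm \<mu> (\<lambda>x. f x + g x) \<le> ell2_norm \<mu> f + ell2_norm \<mu> g"
proof (rule power2_le_imp_le)
  have "Re (ell2_inner \<mu> f g) \<le> ell2_norm \<mu> f * ell2_norm \<mu> g"
    using ell2_Cauchy_Schwarz[OF assms] complex_Re_le_cmod order_trans by blast
  then show "(ell2_norm \<mu> (\<lambda>x. f x + g x))\<^sup>2 \<le> (ell2_norm \<mu> f + ell2_norm \<mu> g)\<^sup>2"
    using ell2_norm_add_square[OF assms] by (simp add: power2_sum)
qed (simp add: ell2_norm_nonneg)

lemma ell2_norm_minus_commute: "ell2_norm \<mu> (\<lambda>x. f x - g x) = ell2_norm \<mu> (\<lambda>x. g x - f x)"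
  by (simp add: ell2_norm_def norm_minus_commute)

lemma ell2_norm_triangle_diff:
  assumes "f \<in> ell2 \<mu>" "g \<in> ell2 \<mu>" "h \<in> ell2 \<mu>"
  shows "ell2_norm \<mu> (\<lambda>x. f x - h x) \<le> ell2_norm \<mu> (\<lambda>x. f x - g x) + ell2_norm \<mu> (\<lambda>x. h x - g x)"
  using ell2_norm_triangle[OF ell2_diff[OF assms(1,2)] ell2_diff[OF assms(2,3)]]
  by (simp add: ell2_norm_minus_commute[of h g])

lemma ell2_norm_eq_0:
  assumes "f \<in> ell2 \<mu>" "ell2_norm \<mu> f = 0"
  shows "f = (\<lambda>x. 0)"
proof
  fix x
  have "\<mu> x * (cmod (f x))\<^sup>2 \<le> 0"
    using ell2_finite_sum_le_norm[OF assms(1), of "{x}"] assms(2) by simp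
  then show "f x = 0"
    using weight_pos[of x] by (simp add: mult_le_0_iff)
qed

text \<open>
  Evaluation at a point is continuous because every point has positive weight, so a Cauchy
  sequence converges pointwise; the Cauchy estimate passes to the pointwise limit on every finite
  set of vertices.
\<close>
lemma ell2_complete:
  assumes F: "\<And>n. F n \<in> ell2 \<mu>"
    and Cauchy: "\<And>e. 0 < e \<Longrightarrow> \<exists>N. \<forall>m\<ge>N. \<forall>n\<ge>N. ell2_norm \<mu> (\<lambda>x. F m x - F n x) \<le> e"
  obtains f where "f \<in> ell2 \<mu>" "(\<lambda>n. ell2_norm \<mu> (\<lambda>x. f x - F n x)) \<longlonglongrightarrow> 0"
proof -
  have pointwise: "sqrt (\<mu> x) * cmod (h x) \<le> ell2_norm \<mu> h" if "h \<in> ell2 \<mu>" for h x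
    using ell2_finite_sum_le_norm[OF that, of "{x}"]
    by (intro power2_le_imp_le[OF _ ell2_norm_nonneg]) (simp add: power_mult_distrib weight_nonneg)
  have "\<exists>l. (\<lambda>n. F n x) \<longlonglongrightarrow> l" for x
  proof -
    have "Cauchy (\<lambda>n. F n x)"
    proof (rule metric_CauchyI)
      fix e :: real assume e: "0 < e"
      then have "0 < sqrt (\<mu> x) * (e / 2)"
        using weight_pos[of x] by simp
      from Cauchy[OF this] obtain N where
        N: "\<And>m n. m \<ge> N \<Longrightarrow> n \<ge> N \<Longrightarrow> ell2_norm \<mu> (\<lambda>x. F m x - F n x) \<le> sqrt (\<mu> x) * (e / 2)"
        by blast
      have "dist (F m x) (F n x) < e" if "m \<ge> N" "n \<ge> N" for m n
      proof -
        have "sqrt (\<mu> x) * cmod (F m x - F n x) \<le> sqrt (\<mu> x) * (e / 2)"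
          using pointwise[OF ell2_diff[OF F F]] N[OF that] order_trans by blast
        then have "cmod (F m x - F n x) \<le> e / 2"
          using weight_pos[of x] by (subst (asm) mult_le_cancel_left_pos) auto
        then show ?thesis
          using e by (simp add: dist_norm)
      qed
      then show "\<exists>M. \<forall>m\<ge>M. \<forall>n\<ge>M. dist (F m x) (F n x) < e"
        by blast
    qed
    then show ?thesis
      by (simp add: Cauchy_convergent_iff convergent_def)
  qed
  then obtain f where lim: "\<And>x. (\<lambda>n. F n x) \<longlonglongrightarrow> f x"
    by metis
  have close: "\<exists>N. \<forall>n\<ge>N. (\<lambda>x. f x - F n x) \<in> ell2 \<mu> \<and> ell2_norm \<mu> (\<lambda>x. f x - F n x) \<le> e"
    if e: "0 < e" for e
  proof -
    obtain N where
      N: "\<And>m n. m \<ge> N \<Longrightarrow> n \<ge> N \<Longrightarrow> ell2_norm \<mu> (\<lambda>x. F m x - F n x) \<le> e"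
      using Cauchy[OF e] by blast
    have "(\<Sum>x\<in>S. \<mu> x * (cmod (f x - F n x))\<^sup>2) \<le> e\<^sup>2" if "n \<ge> N" "finite S" for n S
    proof (rule tendsto_upperbound)
      show "(\<lambda>m. \<Sum>x\<in>S. \<mu> x * (cmod (F m x - F n x))\<^sup>2) \<longlonglongrightarrow> (\<Sum>x\<in>S. \<mu> x * (cmod (f x - F n x))\<^sup>2)"
        by (intro tendsto_intros lim)
      have "(\<Sum>x\<in>S. \<mu> x * (cmod (F m x - F n x))\<^sup>2) \<le> e\<^sup>2" if "m \<ge> N" for m
        using ell2_finite_sum_le_norm[OF ell2_diff[OF F[of m] F[of n]] \<open>finite S\<close>]
          power_mono[OF N[OF that \<open>n \<ge> N\<close>] ell2_norm_nonneg, of 2] by simp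
      then show "\<forall>\<^sub>F m in sequentially. (\<Sum>x\<in>S. \<mu> x * (cmod (F m x - F n x))\<^sup>2) \<le> e\<^sup>2"
        using eventually_sequentially by blast
    qed simp
    then show ?thesis
      using ell2_norm_le_iff_finite_sums[of e] e by auto
  qed
  obtain n where "(\<lambda>x. f x - F n x) \<in> ell2 \<mu>"
    using close[of 1] by auto
  from ell2_add[OF this F[of n]] have "f \<in> ell2 \<mu>"
    by simp
  moreover have "(\<lambda>n. ell2_norm \<mu> (\<lambda>x. f x - F n x)) \<longlonglongrightarrow> 0"
  proof (rule LIMSEQ_I)
    fix r :: real assume "0 < r"
    then obtain N where "\<forall>n\<ge>N. ell2_norm \<mu> (\<lambda>x. f x - F n x) \<le> r / 2"
      using close[of "r / 2"] by auto
    then show "\<exists>N. \<forall>n\<ge>N. norm (ell2_norm \<mu> (\<lambda>x. f x - F n x) - 0) < r"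
      using \<open>0 < r\<close> by (intro exI[of _ N]) (auto simp: ell2_norm_nonneg intro: le_less_trans)
  qed
  ultimately show ?thesis
    using that by blast
qed

lemma ell2_parallelogram:
  assumes "f \<in> ell2 \<mu>" "g \<in> ell2 \<mu>"
  shows "(ell2_norm \<mu> (\<lambda>x. f x - g x))\<^sup>2 + (ell2_norm \<mu> (\<lambda>x. f x + g x))\<^sup>2 =
    2 * (ell2_norm \<mu> f)\<^sup>2 + 2 * (ell2_norm \<mu> g)\<^sup>2"
  using ell2_norm_add_square[OF assms] ell2_norm_diff_square[OF assms] by simp

text \<open>
  The projection theorem in the form needed below. A sequence in \<open>M\<close> whose distance to \<open>f\<close> tends to
  the infimum \<open>d\<close> is Cauchy by the parallelogram identity, and \<open>f\<close> minus its limit is orthogonal to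
  \<open>M\<close> since no element of \<open>M\<close> is closer to \<open>f\<close> than \<open>d\<close>. If only \<open>0\<close> is orthogonal to \<open>M\<close>, the limit
  is \<open>f\<close> itself.
\<close>
lemma ell2_subspace_dense:
  assumes M: "M \<subseteq> ell2 \<mu>" "(\<lambda>x. 0) \<in> M"
    and add: "\<And>f g. f \<in> M \<Longrightarrow> g \<in> M \<Longrightarrow> (\<lambda>x. f x + g x) \<in> M"
    and scale: "\<And>c f. f \<in> M \<Longrightarrow> (\<lambda>x. c * f x) \<in> M"
    and orth: "\<And>g. g \<in> ell2 \<mu> \<Longrightarrow> (\<And>f. f \<in> M \<Longrightarrow> ell2_inner \<mu> f g = 0) \<Longrightarrow> g = (\<lambda>x. 0)"
    and f: "f \<in> ell2 \<mu>" and "0 < e"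
  obtains g where "g \<in> M" "ell2_norm \<mu> (\<lambda>x. f x - g x) < e"
proof -
  let ?D = "(\<lambda>g. ell2_norm \<mu> (\<lambda>x. f x - g x)) ` M"
  define d where "d = Inf ?D"
  have bdd: "bdd_below ?D"
    by (intro bdd_belowI2[where m = 0] ell2_norm_nonneg)
  have d_le: "d \<le> ell2_norm \<mu> (\<lambda>x. f x - g x)" if "g \<in> M" for g
    unfolding d_def using that bdd by (intro cInf_lower) auto
  have d0: "0 \<le> d"
    unfolding d_def using M(2) by (intro cINF_greatest ell2_norm_nonneg) auto
  have "\<exists>g\<in>M. ell2_norm \<mu> (\<lambda>x. f x - g x) < d + 1 / real (Suc n)" for n
  proof -
    have "\<exists>y\<in>?D. y < d + 1 / real (Suc n)"
      unfolding d_def using M(2) bdd by (subst cInf_less_iff[symmetric]) (auto simp: cInf_less_iff)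
    then show ?thesis by auto
  qed
  then obtain G where G: "\<And>n. G n \<in> M"
    and G_lt: "\<And>n. ell2_norm \<mu> (\<lambda>x. f x - G n x) < d + 1 / real (Suc n)"
    by metis
  have Gl: "G n \<in> ell2 \<mu>" for n
    using G M(1) by auto
  have near: "(ell2_norm \<mu> (\<lambda>x. G m x - G n x))\<^sup>2 \<le>
      2 * (d + 1 / real (Suc m))\<^sup>2 + 2 * (d + 1 / real (Suc n))\<^sup>2 - 4 * d\<^sup>2" for m n
  proof -
    let ?f = "\<lambda>x. f x - G n x" and ?g = "\<lambda>x. f x - G m x"
    \<comment> \<open>The midpoint lies in \<open>M\<close>, hence has distance at least \<open>d\<close> from \<open>f\<close>.\<close>
    let ?h = "\<lambda>x. (1 / 2) * (G m x + G n x)"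
    have "?h \<in> M"
      by (intro scale add G)
    then have "d \<le> ell2_norm \<mu> (\<lambda>x. f x - ?h x)"
      by (rule d_le)
    moreover have "(\<lambda>x. ?f x + ?g x) = (\<lambda>x. 2 * (f x - ?h x))"
      by (rule ext) (simp add: field_simps)
    ultimately have "2 * d \<le> ell2_norm \<mu> (\<lambda>x. ?f x + ?g x)"
      using ell2_norm_scale[of 2 "\<lambda>x. f x - ?h x"] by simp
    then have "(2 * d)\<^sup>2 \<le> (ell2_norm \<mu> (\<lambda>x. ?f x + ?g x))\<^sup>2"
      using d0 by (intro power_mono) auto
    moreover have "(\<lambda>x. ?f x - ?g x) = (\<lambda>x. G m x - G n x)"
      by (rule ext) simp
    moreover have "(ell2_norm \<mu> ?f)\<^sup>2 \<le> (d + 1 / real (Suc n))\<^sup>2"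
      "(ell2_norm \<mu> ?g)\<^sup>2 \<le> (d + 1 / real (Suc m))\<^sup>2"
      by (intro power_mono ell2_norm_nonneg less_imp_le[OF G_lt])+
    ultimately show ?thesis
      using ell2_parallelogram[OF ell2_diff[OF f Gl] ell2_diff[OF f Gl], of n m]
      by (simp add: power_mult_distrib)
  qed
  have "\<exists>N. \<forall>m\<ge>N. \<forall>n\<ge>N. ell2_norm \<mu> (\<lambda>x. G m x - G n x) \<le> r" if r: "0 < r" for r
  proof -
    have "(\<lambda>n. 4 * (d + 1 / real (Suc n))\<^sup>2 - 4 * d\<^sup>2) \<longlonglongrightarrow> 4 * (d + 0)\<^sup>2 - 4 * d\<^sup>2"
      using LIMSEQ_inverse_real_of_nat by (intro tendsto_intros) (simp add: inverse_eq_divide)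
    then have "(\<lambda>n. 4 * (d + 1 / real (Suc n))\<^sup>2 - 4 * d\<^sup>2) \<longlonglongrightarrow> 0"
      by simp
    from order_tendstoD(2)[OF this, of "r\<^sup>2"] r obtain N where
      N: "4 * (d + 1 / real (Suc N))\<^sup>2 - 4 * d\<^sup>2 < r\<^sup>2"
      by (auto simp: eventually_sequentially)
    have "ell2_norm \<mu> (\<lambda>x. G m x - G n x) \<le> r" if "m \<ge> N" "n \<ge> N" for m n
    proof (rule power2_le_imp_le)
      have mono: "(d + 1 / real (Suc k))\<^sup>2 \<le> (d + 1 / real (Suc N))\<^sup>2" if "k \<ge> N" for k
        using that d0 by (intro power_mono add_mono) (auto simp: field_simps)
      show "(ell2_norm \<mu> (\<lambda>x. G m x - G n x))\<^sup>2 \<le> r\<^sup>2"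
        using near[of m n] mono[OF that(1)] mono[OF that(2)] N by linarith
    qed (use r in simp)
    then show ?thesis by blast
  qed
  then obtain g where g: "g \<in> ell2 \<mu>" and lim: "(\<lambda>n. ell2_norm \<mu> (\<lambda>x. g x - G n x)) \<longlonglongrightarrow> 0"
    using ell2_complete[of G] Gl by metis
  have g_dist: "ell2_norm \<mu> (\<lambda>x. f x - g x) \<le> d"
  proof (rule tendsto_lowerbound)
    show "(\<lambda>n. d + 1 / real (Suc n) + ell2_norm \<mu> (\<lambda>x. g x - G n x)) \<longlonglongrightarrow> d"
      using tendsto_add[OF tendsto_add[OF tendsto_const[of d] LIMSEQ_inverse_real_of_nat] lim]
      by (simp add: inverse_eq_divide)
    show "\<forall>\<^sub>F n in sequentially. ell2_norm \<mu> (\<lambda>x. f x - g x)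
        \<le> d + 1 / real (Suc n) + ell2_norm \<mu> (\<lambda>x. g x - G n x)"
      using G_lt ell2_norm_triangle_diff[OF f Gl g] by (intro always_eventually allI) (smt (verit))
  qed simp
  have d_le': "d \<le> ell2_norm \<mu> (\<lambda>x. f x - g x - h x)" if "h \<in> M" for h
  proof (rule tendsto_lowerbound)
    show "(\<lambda>n. ell2_norm \<mu> (\<lambda>x. f x - g x - h x) + ell2_norm \<mu> (\<lambda>x. g x - G n x))
        \<longlonglongrightarrow> ell2_norm \<mu> (\<lambda>x. f x - g x - h x)"
      using tendsto_add[OF tendsto_const lim] by simp
    have "d \<le> ell2_norm \<mu> (\<lambda>x. f x - g x - h x) + ell2_norm \<mu> (\<lambda>x. g x - G n x)" for n
    proof -
      have h: "h \<in> ell2 \<mu>"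
        using that M(1) by auto
      have "d \<le> ell2_norm \<mu> (\<lambda>x. f x - (G n x + h x))"
        by (intro d_le add G that)
      moreover have "(\<lambda>x. f x - (G n x + h x)) = (\<lambda>x. (f x - g x - h x) + (g x - G n x))"
        by (rule ext) simp
      ultimately show ?thesis
        using ell2_norm_triangle[OF ell2_diff[OF ell2_diff[OF f g] h] ell2_diff[OF g Gl[of n]]] by simp
    qed
    then show "\<forall>\<^sub>F n in sequentially.
        d \<le> ell2_norm \<mu> (\<lambda>x. f x - g x - h x) + ell2_norm \<mu> (\<lambda>x. g x - G n x)"
      by simp
  qed simp
  let ?r = "\<lambda>x. f x - g x"
  have r: "?r \<in> ell2 \<mu>"
    by (rule ell2_diff[OF f g])
  have Re0: "Re (ell2_inner \<mu> h ?r) = 0" if h: "h \<in> M" for h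
  proof -
    have h': "h \<in> ell2 \<mu>" using h M(1) by auto
    define a where "a = Re (ell2_inner \<mu> h ?r)"
    define c where "c = (ell2_norm \<mu> h)\<^sup>2"
    have ineq: "2 * t * a \<le> t\<^sup>2 * c" for t :: real
    proof -
      have "(ell2_norm \<mu> ?r)\<^sup>2 \<le> (ell2_norm \<mu> (\<lambda>x. ?r x - of_real t * h x))\<^sup>2"
        using order_trans[OF g_dist d_le'[OF scale[OF h, of "of_real t"]]] ell2_norm_nonneg
        by (intro power_mono) auto
      also have "\<dots> = (ell2_norm \<mu> ?r)\<^sup>2 - 2 * t * a + t\<^sup>2 * c"
      proof -
        have "Re (ell2_inner \<mu> ?r h) = a"
          by (metis a_def ell2_inner_cnj complex_cnj(1) cnj.simps(1))
        then show ?thesis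
          using ell2_norm_diff_square[OF r ell2_scale[OF h', of "of_real t"]]
          by (simp add: ell2_inner_scale_right ell2_norm_scale c_def power_mult_distrib)
      qed
      finally show ?thesis by simp
    qed
    have "c \<ge> 0" by (simp add: c_def)
    \<comment> \<open>The inequality is violated at \<open>t = a / (c + 1)\<close> unless \<open>a = 0\<close>; the summand 1 covers \<open>c = 0\<close>.\<close>
    have "2 * (a / (c + 1)) * a \<le> (a / (c + 1))\<^sup>2 * c" by (rule ineq)
    also have "\<dots> \<le> (a / (c + 1))\<^sup>2 * (c + 1)"
      by (intro mult_left_mono) auto
    also have "\<dots> = (a / (c + 1)) * a"
      using \<open>c \<ge> 0\<close> by (simp add: power2_eq_square)
    finally have "a * a / (c + 1) \<le> 0" by simp
    then have "a = 0"
      using \<open>c \<ge> 0\<close> by (auto simp: divide_le_0_iff mult_le_0_iff)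
    then show ?thesis by (simp add: a_def)
  qed
  \<comment> \<open>Replacing \<open>h\<close> by \<open>\<i> h\<close> turns the imaginary part into a real part.\<close>
  have "ell2_inner \<mu> h ?r = 0" if h: "h \<in> M" for h
    using Re0[OF h] Re0[OF scale[OF h, of \<i>]] by (simp add: ell2_inner_scale_left complex_eq_iff)
  then have "?r = (\<lambda>x. 0)"
    by (intro orth r)
  then have "f = g"
    by (simp add: fun_eq_iff)
  then obtain n where "ell2_norm \<mu> (\<lambda>x. f x - G n x) < e"
    using order_tendstoD(2)[OF lim \<open>0 < e\<close>] by (auto simp: eventually_sequentially)
  then show ?thesis
    using that G by blast
qed

end

section \<open>A criterion for essential self-adjointness\<close>

context
  fixes \<mu> :: "'a \<Rightarrow> real" and A :: "'a operator"
  assumes weight_pos: "\<And>x. 0 < \<mu> x"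
    and A_operator: "ell2_operator \<mu> A"
    and A_dense: "densely_defined \<mu> A"
    and A_symmetric: "symmetric_operator \<mu> A"
begin

lemma operator_subset_ell2: "A \<subseteq> ell2 \<mu> \<times> ell2 \<mu>"
  using A_operator by (simp add: ell2_operator_def)

lemma operator_add: "(f, u) \<in> A \<Longrightarrow> (g, v) \<in> A \<Longrightarrow> ((\<lambda>x. f x + g x), (\<lambda>x. u x + v x)) \<in> A"
  using A_operator by (simp add: ell2_operator_def)

lemma operator_scale: "(f, u) \<in> A \<Longrightarrow> ((\<lambda>x. c * f x), (\<lambda>x. c * u x)) \<in> A"
  using A_operator by (simp add: ell2_operator_def)

lemma operator_diff: "(f, u) \<in> A \<Longrightarrow> (g, v) \<in> A \<Longrightarrow> ((\<lambda>x. f x - g x), (\<lambda>x. u x - v x)) \<in> A"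
  using operator_add[of f u "\<lambda>x. - 1 * g x" "\<lambda>x. - 1 * v x"] operator_scale[of g v "-1"] by simp

lemma adjoint_iff:
  "(g, h) \<in> operator_adjoint \<mu> A \<longleftrightarrow>
    g \<in> ell2 \<mu> \<and> h \<in> ell2 \<mu> \<and> (\<forall>f u. (f, u) \<in> A \<longrightarrow> ell2_inner \<mu> u g = ell2_inner \<mu> f h)"
  by (auto simp: operator_adjoint_def)

lemma adjoint_inner: "(g, h) \<in> operator_adjoint \<mu> A \<Longrightarrow> (f, u) \<in> A \<Longrightarrow> ell2_inner \<mu> u g = ell2_inner \<mu> f h"
  by (auto simp: operator_adjoint_def)

lemma operator_subset_closure: "A \<subseteq> operator_closure \<mu> A"
proof -
  have "ell2_norm \<mu> (\<lambda>x. f x - f x) < e" if "0 < e" for f :: "'a \<Rightarrow> complex" and e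
    using that by (simp add: ell2_norm_def)
  then show ?thesis
    using operator_subset_ell2 unfolding operator_closure_def by blast
qed

text \<open>
  The defining identity of the adjoint is continuous in both components of the pair
  \<open>(f, u)\<close>, so it persists on the closure.
\<close>
lemma closure_adjoint_inner:
  assumes fu: "(f, u) \<in> operator_closure \<mu> A" and gh: "(g, h) \<in> operator_adjoint \<mu> A"
  shows "ell2_inner \<mu> u g = ell2_inner \<mu> f h"
proof -
  let ?C = "ell2_norm \<mu> g + ell2_norm \<mu> h"
  have ell2: "f \<in> ell2 \<mu>" "u \<in> ell2 \<mu>" "g \<in> ell2 \<mu>" "h \<in> ell2 \<mu>"
    using fu gh by (auto simp: operator_closure_def operator_adjoint_def)
  have "cmod (ell2_inner \<mu> u g - ell2_inner \<mu> f h) \<le> 0 + e" if "0 < e" for e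
  proof -
    have C: "0 \<le> ?C"
      using ell2_norm_nonneg[of \<mu>, OF weight_pos] by (intro add_nonneg_nonneg)
    define d where "d = e / (?C + 1)"
    have d: "0 < d"
      using that C by (simp add: d_def)
    then obtain f' u' where A': "(f', u') \<in> A"
      and close: "ell2_norm \<mu> (\<lambda>x. f x - f' x) < d" "ell2_norm \<mu> (\<lambda>x. u x - u' x) < d"
      using fu by (fastforce simp: operator_closure_def)
    have ell2': "f' \<in> ell2 \<mu>" "u' \<in> ell2 \<mu>"
      using A' operator_subset_ell2 by auto
    have "ell2_inner \<mu> u g - ell2_inner \<mu> f h =
        ell2_inner \<mu> (\<lambda>x. u x - u' x) g - ell2_inner \<mu> (\<lambda>x. f x - f' x) h"
      using adjoint_inner[OF gh A'] ell2 ell2'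
      by (simp add: ell2_inner_diff_left[OF weight_pos])
    then have "cmod (ell2_inner \<mu> u g - ell2_inner \<mu> f h) \<le>
        cmod (ell2_inner \<mu> (\<lambda>x. u x - u' x) g) + cmod (ell2_inner \<mu> (\<lambda>x. f x - f' x) h)"
      by (simp add: norm_triangle_ineq4)
    also have "\<dots> \<le> ell2_norm \<mu> (\<lambda>x. u x - u' x) * ell2_norm \<mu> g +
        ell2_norm \<mu> (\<lambda>x. f x - f' x) * ell2_norm \<mu> h"
      using ell2 ell2' by (intro add_mono ell2_Cauchy_Schwarz weight_pos ell2_diff)
    also have "\<dots> \<le> d * ell2_norm \<mu> g + d * ell2_norm \<mu> h"
      using close by (intro add_mono mult_right_mono ell2_norm_nonneg weight_pos) auto
    also have "\<dots> = d * ?C"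
      by (simp add: algebra_simps)
    also have "\<dots> \<le> e"
      using that C by (simp add: d_def field_simps)
    finally show ?thesis by simp
  qed
  then have "cmod (ell2_inner \<mu> u g - ell2_inner \<mu> f h) \<le> 0"
    by (rule field_le_epsilon)
  then show ?thesis by simp
qed

lemma operator_subset_adjoint: "A \<subseteq> operator_adjoint \<mu> A"
  using A_symmetric operator_subset_ell2
  unfolding symmetric_operator_def operator_adjoint_def by fastforce

lemma closure_subset_adjoint: "operator_closure \<mu> A \<subseteq> operator_adjoint \<mu> A"
proof (clarify)
  fix f u assume fu: "(f, u) \<in> operator_closure \<mu> A"
  have "ell2_inner \<mu> v f = ell2_inner \<mu> g u" if "(g, v) \<in> A" for g v
  proof -
    have "ell2_inner \<mu> u g = ell2_inner \<mu> f v"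
      using closure_adjoint_inner[OF fu] operator_subset_adjoint that by blast
    from arg_cong[OF this, of cnj] show ?thesis
      by (simp add: ell2_inner_cnj[OF weight_pos])
  qed
  then show "(f, u) \<in> operator_adjoint \<mu> A"
    using fu by (auto simp: operator_adjoint_def operator_closure_def)
qed

lemma adjoint_of_closure: "operator_adjoint \<mu> (operator_closure \<mu> A) = operator_adjoint \<mu> A"
proof
  show "operator_adjoint \<mu> (operator_closure \<mu> A) \<subseteq> operator_adjoint \<mu> A"
    using operator_subset_closure unfolding operator_adjoint_def by blast
  show "operator_adjoint \<mu> A \<subseteq> operator_adjoint \<mu> (operator_closure \<mu> A)"
    using closure_adjoint_inner by (auto simp: operator_adjoint_def[of \<mu> "operator_closure \<mu> A"])
      (auto simp: operator_adjoint_def)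
qed

lemma adjoint_single_valued: "single_valued (operator_adjoint \<mu> A)"
proof (rule single_valuedI)
  fix g h h' assume gh: "(g, h) \<in> operator_adjoint \<mu> A" "(g, h') \<in> operator_adjoint \<mu> A"
  let ?k = "\<lambda>x. h x - h' x"
  have h: "h \<in> ell2 \<mu>" "h' \<in> ell2 \<mu>"
    using gh by (auto simp: operator_adjoint_def)
  have k: "?k \<in> ell2 \<mu>"
    using h by (intro ell2_diff weight_pos)
  have orth: "ell2_inner \<mu> f ?k = 0" if "f \<in> Domain A" for f
  proof -
    from that obtain u where fu: "(f, u) \<in> A"
      by blast
    moreover have "f \<in> ell2 \<mu>"
      using fu operator_subset_ell2 by auto
    ultimately show ?thesis
      using adjoint_inner[OF gh(1)] adjoint_inner[OF gh(2)] h
      by (simp add: ell2_inner_diff_right[OF weight_pos])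
  qed
  have "ell2_norm \<mu> ?k = 0"
  proof (rule ccontr)
    assume "ell2_norm \<mu> ?k \<noteq> 0"
    then have pos: "0 < ell2_norm \<mu> ?k"
      using ell2_norm_nonneg[of \<mu> ?k, OF weight_pos] by simp
    from A_dense[unfolded densely_defined_def, rule_format, OF k pos]
    obtain f where f: "f \<in> Domain A" "ell2_norm \<mu> (\<lambda>x. ?k x - f x) < ell2_norm \<mu> ?k"
      by (rule bexE)
    then have f': "f \<in> ell2 \<mu>"
      using operator_subset_ell2 by auto
    have "(ell2_norm \<mu> ?k)\<^sup>2 = cmod (ell2_inner \<mu> ?k ?k)"
      by (simp add: ell2_inner_self[OF weight_pos k] norm_power)
    also have "\<dots> = cmod (ell2_inner \<mu> (\<lambda>x. ?k x - f x) ?k)"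
      using orth[OF f(1)] ell2_inner_diff_left[of \<mu> ?k f ?k, OF weight_pos k f' k] by simp
    also have "\<dots> \<le> ell2_norm \<mu> (\<lambda>x. ?k x - f x) * ell2_norm \<mu> ?k"
      using k f' by (intro ell2_Cauchy_Schwarz weight_pos ell2_diff[of \<mu> ?k f])
    also have "\<dots> < (ell2_norm \<mu> ?k)\<^sup>2"
      using f(2) pos by (simp add: power2_eq_square)
    finally show False by simp
  qed
  then show "h = h'"
    using ell2_norm_eq_0[OF weight_pos k] by (simp add: fun_eq_iff)
qed

lemma adjoint_operator: "ell2_operator \<mu> (operator_adjoint \<mu> A)"
  unfolding ell2_operator_def
proof (intro conjI allI impI)
  show "operator_adjoint \<mu> A \<subseteq> ell2 \<mu> \<times> ell2 \<mu>"
    by (auto simp: operator_adjoint_def)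
  show "((\<lambda>x. 0), (\<lambda>x. 0)) \<in> operator_adjoint \<mu> A"
    by (auto simp: operator_adjoint_def ell2_inner_def ell2_def)
  fix f u g v assume "(f, u) \<in> operator_adjoint \<mu> A" "(g, v) \<in> operator_adjoint \<mu> A"
  then show "((\<lambda>x. f x + g x), (\<lambda>x. u x + v x)) \<in> operator_adjoint \<mu> A"
    using operator_subset_ell2 unfolding adjoint_iff
    by (auto simp: ell2_add[OF weight_pos] ell2_inner_add_right[OF weight_pos] subset_iff)
next
  fix c :: complex and f u assume "(f, u) \<in> operator_adjoint \<mu> A"
  then show "((\<lambda>x. c * f x), (\<lambda>x. c * u x)) \<in> operator_adjoint \<mu> A"
    unfolding adjoint_iff
    by (auto simp: ell2_scale[OF weight_pos] ell2_inner_scale_right[OF weight_pos])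
qed (rule adjoint_single_valued)

text \<open>
  The mixed terms cancel because \<open>(A f, f)\<close> is real for symmetric \<open>A\<close>. Hence convergence of
  \<open>(A + \<i>) f\<^sub>n\<close> forces convergence of both \<open>f\<^sub>n\<close> and \<open>A f\<^sub>n\<close>.
\<close>
lemma norm_add_i_square:
  assumes "(f, u) \<in> A"
  shows "(ell2_norm \<mu> (\<lambda>x. u x + \<i> * f x))\<^sup>2 = (ell2_norm \<mu> u)\<^sup>2 + (ell2_norm \<mu> f)\<^sup>2"
proof -
  have ell2: "f \<in> ell2 \<mu>" "u \<in> ell2 \<mu>"
    using assms operator_subset_ell2 by auto
  have "ell2_inner \<mu> u f = ell2_inner \<mu> f u"
    using A_symmetric assms by (auto simp: symmetric_operator_def)
  then have "Im (ell2_inner \<mu> u f) = 0"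
    using ell2_inner_cnj[of \<mu> u f, OF weight_pos] by (simp add: complex_eq_iff)
  then show ?thesis
    using ell2_norm_add_square[of \<mu> u "\<lambda>x. \<i> * f x", OF weight_pos ell2(2) ell2_scale[OF weight_pos ell2(1)]]
    by (simp add: ell2_inner_scale_right[OF weight_pos] ell2_norm_scale[OF weight_pos])
qed

lemma norms_le_norm_add_i:
  assumes "(f, u) \<in> A"
  shows "ell2_norm \<mu> f \<le> ell2_norm \<mu> (\<lambda>x. u x + \<i> * f x)"
    and "ell2_norm \<mu> u \<le> ell2_norm \<mu> (\<lambda>x. u x + \<i> * f x)"
  by (rule power2_le_imp_le, simp add: norm_add_i_square[OF assms], rule ell2_norm_nonneg[OF weight_pos])+

text \<open>
  A vector orthogonal to the range of \<open>A + \<i>\<close> is an eigenvector of the adjoint with eigenvalue \<open>\<i>\<close>.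
\<close>
lemma range_add_i_dense:
  assumes no_eigenvector: "\<And>w. (w, \<lambda>x. \<i> * w x) \<in> operator_adjoint \<mu> A \<Longrightarrow> w = (\<lambda>x. 0)"
    and "k \<in> ell2 \<mu>" "0 < e"
  obtains f u where "(f, u) \<in> A" "ell2_norm \<mu> (\<lambda>x. k x - (u x + \<i> * f x)) < e"
proof -
  define M where "M = {\<lambda>x. u x + \<i> * f x | f u. (f, u) \<in> A}"
  have M_I: "(\<lambda>x. u x + \<i> * f x) \<in> M" if "(f, u) \<in> A" for f u
    using that by (auto simp: M_def)
  obtain g where "g \<in> M" "ell2_norm \<mu> (\<lambda>x. k x - g x) < e"
  proof (rule ell2_subspace_dense[of \<mu> M k e, OF weight_pos])
    show "M \<subseteq> ell2 \<mu>"
      using operator_subset_ell2 by (auto simp: M_def intro!: ell2_add ell2_scale weight_pos)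
    show "(\<lambda>x. 0) \<in> M"
      using M_I[of "\<lambda>x. 0" "\<lambda>x. 0"] A_operator by (simp add: ell2_operator_def)
  next
    fix f g assume "f \<in> M" "g \<in> M"
    then obtain f' u g' v where A': "(f', u) \<in> A" "(g', v) \<in> A"
      and "f = (\<lambda>x. u x + \<i> * f' x)" "g = (\<lambda>x. v x + \<i> * g' x)"
      by (auto simp: M_def)
    then show "(\<lambda>x. f x + g x) \<in> M"
      using M_I[OF operator_add[OF A']] by (simp add: algebra_simps)
  next
    fix c f assume "f \<in> M"
    then obtain f' u where A': "(f', u) \<in> A" and "f = (\<lambda>x. u x + \<i> * f' x)"
      by (auto simp: M_def)
    then show "(\<lambda>x. c * f x) \<in> M"
      using M_I[OF operator_scale[OF A', of c]] by (simp add: algebra_simps)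
  next
    fix g assume g: "g \<in> ell2 \<mu>" and orth: "\<And>f. f \<in> M \<Longrightarrow> ell2_inner \<mu> f g = 0"
    have "ell2_inner \<mu> u g = ell2_inner \<mu> f (\<lambda>x. \<i> * g x)" if fu: "(f, u) \<in> A" for f u
    proof -
      have ell2: "f \<in> ell2 \<mu>" "u \<in> ell2 \<mu>"
        using fu operator_subset_ell2 by auto
      have "ell2_inner \<mu> u g + \<i> * ell2_inner \<mu> f g = 0"
        using orth[OF M_I[OF fu]] ell2 g
        by (simp add: ell2_inner_add_left[OF weight_pos] ell2_inner_scale_left[OF weight_pos] ell2_scale[OF weight_pos])
      then show ?thesis
        by (simp add: ell2_inner_scale_right[OF weight_pos] eq_neg_iff_add_eq_0)
    qed
    then have "(g, \<lambda>x. \<i> * g x) \<in> operator_adjoint \<mu> A"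
      using g by (auto simp: operator_adjoint_def ell2_scale[OF weight_pos])
    then show "g = (\<lambda>x. 0)"
      by (rule no_eigenvector)
  qed (use assms in auto)
  then show ?thesis
    using that by (auto simp: M_def)
qed

text \<open>
  Given a pair \<open>(g, h)\<close> of the adjoint, the density of the range gives \<open>f\<^sub>n\<close> with
  \<open>(A + \<i>) f\<^sub>n\<close> tending to \<open>h + \<i> g\<close>. By the norm identity above \<open>(f\<^sub>n, A f\<^sub>n)\<close> converges to a pair
  \<open>(f, u)\<close> of the closure with \<open>u + \<i> f = h + \<i> g\<close>. The difference of the two pairs is an eigenvector
  of the adjoint with eigenvalue \<open>- \<i>\<close>, so the pairs coincide.
\<close>
lemma adjoint_subset_closure:
  assumes plus: "\<And>w. (w, \<lambda>x. \<i> * w x) \<in> operator_adjoint \<mu> A \<Longrightarrow> w = (\<lambda>x. 0)"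
    and minus: "\<And>w. (w, \<lambda>x. - \<i> * w x) \<in> operator_adjoint \<mu> A \<Longrightarrow> w = (\<lambda>x. 0)"
  shows "operator_adjoint \<mu> A \<subseteq> operator_closure \<mu> A"
proof (clarify)
  fix g h assume gh: "(g, h) \<in> operator_adjoint \<mu> A"
  then have g: "g \<in> ell2 \<mu>" and h: "h \<in> ell2 \<mu>"
    by (auto simp: operator_adjoint_def)
  let ?k = "\<lambda>x. h x + \<i> * g x"
  have k: "?k \<in> ell2 \<mu>"
    using g h by (intro ell2_add ell2_scale weight_pos)
  have "\<exists>fu\<in>A. ell2_norm \<mu> (\<lambda>x. ?k x - (snd fu x + \<i> * fst fu x)) < 1 / real (Suc n)" for n
  proof -
    have "0 < 1 / real (Suc n)"
      by simp
    with plus k obtain f u where "(f, u) \<in> A" "ell2_norm \<mu> (\<lambda>x. ?k x - (u x + \<i> * f x)) < 1 / real (Suc n)"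
      by (rule range_add_i_dense)
    then show ?thesis
      by (intro bexI[of _ "(f, u)"]) simp_all
  qed
  then obtain FU where FU: "\<And>n. FU n \<in> A" and
    FU_lt: "\<And>n. ell2_norm \<mu> (\<lambda>x. ?k x - (snd (FU n) x + \<i> * fst (FU n) x)) < 1 / real (Suc n)"
    by metis
  define F where "F n = fst (FU n)" for n
  define U where "U n = snd (FU n)" for n
  have FA: "(F n, U n) \<in> A" for n
    using FU by (simp add: F_def U_def)
  have F: "F n \<in> ell2 \<mu>" and U: "U n \<in> ell2 \<mu>" for n
    using FA[of n] operator_subset_ell2 by auto
  let ?K = "\<lambda>n x. U n x + \<i> * F n x"
  have K: "?K n \<in> ell2 \<mu>" for n
    using F U by (intro ell2_add ell2_scale weight_pos)
  have K_lt: "ell2_norm \<mu> (\<lambda>x. ?k x - ?K n x) < 1 / real (Suc n)" for n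
    using FU_lt by (simp add: F_def U_def)
  have Cauchy: "\<exists>N. \<forall>m\<ge>N. \<forall>n\<ge>N. ell2_norm \<mu> (\<lambda>x. ?K m x - ?K n x) \<le> e" if e: "0 < e" for e
  proof -
    obtain N where N: "1 / real (Suc N) < e / 2"
      using e by (meson half_gt_zero nat_approx_posE)
    have "ell2_norm \<mu> (\<lambda>x. ?K m x - ?K n x) \<le> e" if "m \<ge> N" "n \<ge> N" for m n
    proof -
      have small: "1 / real (Suc j) \<le> 1 / real (Suc N)" if "j \<ge> N" for j
        using that by (simp add: field_simps)
      show ?thesis
        using ell2_norm_triangle_diff[OF weight_pos K[of m] k K[of n]] K_lt[of m] K_lt[of n]
          small[OF that(1)] small[OF that(2)] N
        unfolding ell2_norm_minus_commute[OF weight_pos, of _ ?k] by linarith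
    qed
    then show ?thesis by blast
  qed
  have diff: "((\<lambda>x. F m x - F n x), (\<lambda>x. U m x - U n x)) \<in> A" for m n
    by (intro operator_diff FA)
  have eq: "(\<lambda>x. (U m x - U n x) + \<i> * (F m x - F n x)) = (\<lambda>x. ?K m x - ?K n x)" for m n
    by (simp add: fun_eq_iff algebra_simps)
  obtain f where f: "f \<in> ell2 \<mu>" and f_lim: "(\<lambda>n. ell2_norm \<mu> (\<lambda>x. f x - F n x)) \<longlonglongrightarrow> 0"
  proof (rule ell2_complete[of \<mu> F, OF weight_pos F])
    show "\<exists>N. \<forall>m\<ge>N. \<forall>n\<ge>N. ell2_norm \<mu> (\<lambda>x. F m x - F n x) \<le> e" if "0 < e" for e
      using Cauchy[OF that] norms_le_norm_add_i(1)[OF diff] unfolding eq by (meson order_trans)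
  qed
  obtain u where u: "u \<in> ell2 \<mu>" and u_lim: "(\<lambda>n. ell2_norm \<mu> (\<lambda>x. u x - U n x)) \<longlonglongrightarrow> 0"
  proof (rule ell2_complete[of \<mu> U, OF weight_pos U])
    show "\<exists>N. \<forall>m\<ge>N. \<forall>n\<ge>N. ell2_norm \<mu> (\<lambda>x. U m x - U n x) \<le> e" if "0 < e" for e
      using Cauchy[OF that] norms_le_norm_add_i(2)[OF diff] unfolding eq by (meson order_trans)
  qed
  have fu: "(f, u) \<in> operator_closure \<mu> A"
    unfolding operator_closure_def
  proof (clarsimp simp: f u)
    fix e :: real assume "0 < e"
    then have "\<forall>\<^sub>F n in sequentially. ell2_norm \<mu> (\<lambda>x. f x - F n x) < e \<and> ell2_norm \<mu> (\<lambda>x. u x - U n x) < e"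
      using order_tendstoD(2)[OF f_lim] order_tendstoD(2)[OF u_lim] by (intro eventually_conj)
    then show "\<exists>(g, v)\<in>A. ell2_norm \<mu> (\<lambda>x. f x - g x) < e \<and> ell2_norm \<mu> (\<lambda>x. u x - v x) < e"
      using FA by (auto simp: eventually_sequentially)
  qed
  let ?r = "\<lambda>x. ?k x - (u x + \<i> * f x)"
  have r: "?r \<in> ell2 \<mu>"
    using k u f by (intro ell2_diff[of \<mu> ?k] ell2_add[of \<mu> u] ell2_scale weight_pos)
  have bound: "ell2_norm \<mu> ?r \<le> inverse (real (Suc n)) +
      (ell2_norm \<mu> (\<lambda>x. u x - U n x) + ell2_norm \<mu> (\<lambda>x. f x - F n x))" for n
  proof -
    let ?l = "\<lambda>x. u x + \<i> * f x"
    have l: "?l \<in> ell2 \<mu>"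
      using u f by (intro ell2_add[of \<mu> u] ell2_scale weight_pos)
    have "ell2_norm \<mu> ?r \<le> ell2_norm \<mu> (\<lambda>x. ?k x - ?K n x) + ell2_norm \<mu> (\<lambda>x. ?l x - ?K n x)"
      by (rule ell2_norm_triangle_diff[OF weight_pos k K l])
    also have "(\<lambda>x. ?l x - ?K n x) = (\<lambda>x. (u x - U n x) + \<i> * (f x - F n x))"
      by (simp add: fun_eq_iff algebra_simps)
    also have "ell2_norm \<mu> \<dots> \<le> ell2_norm \<mu> (\<lambda>x. u x - U n x) + ell2_norm \<mu> (\<lambda>x. \<i> * (f x - F n x))"
      using u f U F by (intro ell2_norm_triangle ell2_diff ell2_scale weight_pos)
    also have "ell2_norm \<mu> (\<lambda>x. \<i> * (f x - F n x)) = ell2_norm \<mu> (\<lambda>x. f x - F n x)"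
      by (simp add: ell2_norm_scale[OF weight_pos])
    finally show ?thesis
      using K_lt[of n] by (simp add: inverse_eq_divide)
  qed
  have "ell2_norm \<mu> ?r \<le> 0"
  proof (rule tendsto_lowerbound)
    show "(\<lambda>n. inverse (real (Suc n)) +
      (ell2_norm \<mu> (\<lambda>x. u x - U n x) + ell2_norm \<mu> (\<lambda>x. f x - F n x))) \<longlonglongrightarrow> 0"
      using tendsto_add[OF LIMSEQ_inverse_real_of_nat tendsto_add[OF u_lim f_lim]] by simp
  qed (use bound in auto)
  then have "ell2_norm \<mu> ?r = 0"
    using ell2_norm_nonneg[of \<mu> ?r, OF weight_pos] by simp
  then have r0: "?r x = 0" for x
    using ell2_norm_eq_0[OF weight_pos r] by (simp add: fun_eq_iff)
  have "((\<lambda>x. g x + - 1 * f x), (\<lambda>x. h x + - 1 * u x)) \<in> operator_adjoint \<mu> A"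
    using adjoint_operator gh fu closure_subset_adjoint unfolding ell2_operator_def by blast
  also have "(\<lambda>x. h x + - 1 * u x) = (\<lambda>x. - \<i> * (g x + - 1 * f x))"
    using r0 by (simp add: fun_eq_iff algebra_simps)
  finally have "(\<lambda>x. g x + - 1 * f x) = (\<lambda>x. 0)"
    by (rule minus)
  then have "g = f"
    by (simp add: fun_eq_iff)
  moreover from this have "h = u"
    using r0 by (simp add: fun_eq_iff)
  ultimately show "(g, h) \<in> operator_closure \<mu> A"
    using fu by simp
qed

text \<open>
  Von Neumann's criterion. If both deficiency spaces vanish, the closure equals the adjoint. As an
  operator and its closure have the same adjoint, the closure is then its own adjoint.
\<close>
theorem basic_criterion_essential_self_adjointness:
  assumes plus: "\<And>w. (w, \<lambda>x. \<i> * w x) \<in> operator_adjoint \<mu> A \<Longrightarrow> w = (\<lambda>x. 0)"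
    and minus: "\<And>w. (w, \<lambda>x. - \<i> * w x) \<in> operator_adjoint \<mu> A \<Longrightarrow> w = (\<lambda>x. 0)"
  shows "essentially_self_adjoint \<mu> A"
proof -
  have eq: "operator_closure \<mu> A = operator_adjoint \<mu> A"
    using closure_subset_adjoint adjoint_subset_closure[OF assms] by blast
  have "Domain A \<subseteq> Domain (operator_closure \<mu> A)"
    using operator_subset_closure by blast
  then have "densely_defined \<mu> (operator_closure \<mu> A)"
    using A_dense unfolding densely_defined_def by (meson subsetD)
  then have "self_adjoint \<mu> (operator_closure \<mu> A)"
    using adjoint_operator adjoint_of_closure eq by (simp add: self_adjoint_def)
  then show ?thesis
    using A_operator A_dense A_symmetric by (simp add: essentially_self_adjoint_def)
qed

end

section \<open>The minimal Schroedinger operator and its adjoint\<close>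

definition formal_schroedinger ::
  "('v \<Rightarrow> 'v \<Rightarrow> real) \<Rightarrow> ('v \<Rightarrow> real) \<Rightarrow> ('v \<Rightarrow> real) \<Rightarrow> ('v \<Rightarrow> complex) \<Rightarrow> 'v \<Rightarrow> complex" where
  "formal_schroedinger b \<mu> V f x =
     of_real (1 / \<mu> x) * (\<Sum>\<^sub>\<infinity>y. of_real (b x y) * (f x - f y)) + of_real (V x) * f x"

lemma schroedinger_eq: "schroedinger b \<mu> V = {(f, formal_schroedinger b \<mu> V f) | f. f \<in> formal_domain b}"
  by (simp add: schroedinger_def formal_schroedinger_def[abs_def])

lemma has_sum_finite_sum:
  fixes F :: "'a \<Rightarrow> 'b \<Rightarrow> 'c::topological_comm_monoid_add"
  assumes "finite S" "\<And>y. y \<in> S \<Longrightarrow> (F y has_sum s y) A"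
  shows "((\<lambda>x. \<Sum>y\<in>S. F y x) has_sum (\<Sum>y\<in>S. s y)) A"
  using assms by (induction S rule: finite_induct) (auto intro: has_sum_add)

context
  fixes b :: "'v::countable \<Rightarrow> 'v \<Rightarrow> real"
  assumes graph: "weighted_graph b"
begin

lemma edge_nonneg: "0 \<le> b x y"
  and edge_symmetric: "b x y = b y x"
  and edge_summable: "b x summable_on UNIV"
  using graph by (auto simp: weighted_graph_def)

context
  fixes \<mu> V :: "'v \<Rightarrow> real"
  assumes weight_pos: "\<And>x. 0 < \<mu> x"
begin

abbreviation "\<L> \<equiv> formal_schroedinger b \<mu> V"

abbreviation "deg x \<equiv> (\<Sum>\<^sub>\<infinity>y. b x y)"

lemma neighbour_sum_summable:
  assumes "f \<in> formal_domain b"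
  shows "(\<lambda>y. of_real (b x y) * f y) summable_on UNIV"
  by (rule abs_summable_summable) (use assms in \<open>simp add: formal_domain_def norm_mult edge_nonneg\<close>)

lemma laplacian_has_sum:
  assumes "f \<in> formal_domain b"
  shows "((\<lambda>y. of_real (b x y) * (f x - f y)) has_sum of_real (\<mu> x) * (\<L> f x - of_real (V x) * f x)) UNIV"
proof -
  have "(\<lambda>y. of_real (b x y) * f x + - 1 * (of_real (b x y) * f y)) summable_on UNIV"
    by (intro summable_on_add summable_on_cmult_right summable_on_cmult_left summable_on_of_real
        edge_summable neighbour_sum_summable assms)
  then have "((\<lambda>y. of_real (b x y) * (f x - f y)) has_sum (\<Sum>\<^sub>\<infinity>y. of_real (b x y) * (f x - f y))) UNIV"
    by (intro has_sum_infsum) (simp add: algebra_simps)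
  then show ?thesis
    using weight_pos[of x] by (simp add: formal_schroedinger_def field_simps)
qed

lemma schroedinger_degree_form:
  assumes "f \<in> formal_domain b"
  shows "of_real (\<mu> x) * \<L> f x =
    of_real (deg x + \<mu> x * V x) * f x - (\<Sum>\<^sub>\<infinity>y. of_real (b x y) * f y)"
proof -
  have "((\<lambda>y. of_real (b x y) * f x + - 1 * (of_real (b x y) * f y)) has_sum
      of_real (deg x) * f x + - 1 * (\<Sum>\<^sub>\<infinity>y. of_real (b x y) * f y)) UNIV"
    by (intro has_sum_add has_sum_cmult_right has_sum_cmult_left has_sum_of_real has_sum_infsum
        edge_summable neighbour_sum_summable assms)
  then have "((\<lambda>y. of_real (b x y) * (f x - f y)) has_sum
      of_real (deg x) * f x - (\<Sum>\<^sub>\<infinity>y. of_real (b x y) * f y)) UNIV"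
    by (simp add: algebra_simps)
  from has_sum_unique[OF laplacian_has_sum[OF assms] this] show ?thesis
    by (simp add: algebra_simps)
qed

lemma neighbour_sum_finite:
  fixes f :: "'v \<Rightarrow> complex"
  assumes "finite S" "\<And>y. y \<notin> S \<Longrightarrow> f y = 0"
  shows "(\<Sum>\<^sub>\<infinity>y. of_real (b x y) * f y) = (\<Sum>y\<in>S. of_real (b x y) * f y)"
  using assms by (intro infsumI has_sum_finite_neutralI) auto

context
  assumes FC: "finiteness_condition b \<mu>"
begin

text \<open>
  The finiteness condition is used twice. Here, \<open>\<Sum>\<^sub>y b x y |f y|\<close> is the pairing of \<open>|f|\<close> with
  \<open>y \<mapsto> b x y / \<mu> y\<close>, so the formal operator is defined on all of \<open>ell2\<close>; below, the same functions are,
  up to sign, the off-diagonal parts of the images of the point masses, so the operator maps finitely supported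
  functions into \<open>ell2\<close>.
\<close>
lemma ell2_subset_formal_domain: "ell2 \<mu> \<subseteq> formal_domain b"
proof
  fix f assume "f \<in> ell2 \<mu>"
  then have "(\<lambda>y. cmod (of_real (\<mu> y) * f y * cnj (of_real (b x y / \<mu> y)))) summable_on UNIV" for x
    using FC by (intro ell2_inner_abs_summable weight_pos) (auto simp: finiteness_condition_def)
  also have "(\<lambda>y. cmod (of_real (\<mu> y) * f y * cnj (of_real (b x y / \<mu> y)))) =
      (\<lambda>y. b x y * cmod (f y))" for x
    using weight_pos by (simp add: fun_eq_iff norm_mult norm_divide edge_nonneg less_imp_neq[symmetric] abs_of_pos)
  finally show "f \<in> formal_domain b"
    by (simp add: formal_domain_def)
qed

lemma finitely_supported_formal_domain: "f \<in> finitely_supported \<Longrightarrow> f \<in> formal_domain b"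
  using finitely_supported_subset_ell2[of \<mu>, OF weight_pos] ell2_subset_formal_domain by blast

lemma schroedinger_finitely_supported_ell2:
  assumes f: "f \<in> finitely_supported"
  shows "\<L> f \<in> ell2 \<mu>"
proof -
  define S where "S = {x. f x \<noteq> 0}"
  have S: "finite S" "\<And>y. y \<notin> S \<Longrightarrow> f y = 0"
    using f by (auto simp: S_def finitely_supported_def)
  have N: "(\<Sum>\<^sub>\<infinity>y. of_real (b x y) * f y) = (\<Sum>y\<in>S. of_real (b x y) * f y)" for x
    using S by (rule neighbour_sum_finite)
  have "{x. of_real (deg x / \<mu> x + V x) * f x \<noteq> 0} \<subseteq> S"
    by (auto simp: S_def)
  then have "(\<lambda>x. of_real (deg x / \<mu> x + V x) * f x) \<in> finitely_supported"
    unfolding finitely_supported_def by (intro CollectI finite_subset[OF _ S(1)])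
  then have diag: "(\<lambda>x. of_real (deg x / \<mu> x + V x) * f x) \<in> ell2 \<mu>"
    by (rule subsetD[OF finitely_supported_subset_ell2[OF weight_pos]])
  have "(\<lambda>x. of_real (b y x / \<mu> x)) \<in> ell2 \<mu>" for y
    using FC by (auto simp: finiteness_condition_def)
  then have off: "(\<lambda>x. \<Sum>y\<in>S. f y * of_real (b y x / \<mu> x)) \<in> ell2 \<mu>"
    by (intro ell2_sum ell2_scale weight_pos S)
  have "\<L> f x = of_real (deg x / \<mu> x + V x) * f x - (\<Sum>y\<in>S. f y * of_real (b y x / \<mu> x))" for x
  proof -
    have "\<L> f x = of_real (\<mu> x) * \<L> f x / of_real (\<mu> x)"
      using weight_pos[of x] by simp
    also have "\<dots> = (of_real (deg x + \<mu> x * V x) * f x - (\<Sum>y\<in>S. of_real (b x y) * f y)) / of_real (\<mu> x)"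
      unfolding schroedinger_degree_form[OF finitely_supported_formal_domain[OF f]] N ..
    also have "\<dots> = of_real (deg x / \<mu> x + V x) * f x - (\<Sum>y\<in>S. of_real (b x y) * f y / of_real (\<mu> x))"
      unfolding sum_divide_distrib[symmetric] using weight_pos[of x] by (simp add: field_simps)
    finally show ?thesis
      by (simp add: edge_symmetric[of x] mult_ac)
  qed
  then have "\<L> f = (\<lambda>x. of_real (deg x / \<mu> x + V x) * f x - (\<Sum>y\<in>S. f y * of_real (b y x / \<mu> x)))"
    by (rule ext)
  then show ?thesis
    using ell2_diff[of \<mu>, OF weight_pos diag off] by simp
qed

text \<open>
  Splitting the operator into its diagonal and its off-diagonal part leaves only finite sums
  over the support of \<open>f\<close> to be interchanged with one convergent series. Therefore \<open>g\<close> need not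
  have finite support, which is what the computation of the adjoint requires.
\<close>
lemma green_formula:
  assumes f: "f \<in> finitely_supported" and g: "g \<in> formal_domain b"
  shows "ell2_inner \<mu> (\<L> f) g = ell2_inner \<mu> f (\<L> g)"
proof -
  define S where "S = {x. f x \<noteq> 0}"
  have S: "finite S" "\<And>y. y \<notin> S \<Longrightarrow> f y = 0"
    using f by (auto simp: S_def finitely_supported_def)
  have N: "(\<Sum>\<^sub>\<infinity>y. of_real (b x y) * f y) = (\<Sum>y\<in>S. of_real (b x y) * f y)" for x
    using S by (rule neighbour_sum_finite)
  let ?d = "\<lambda>x. of_real (deg x + \<mu> x * V x) :: complex"
  let ?N = "\<lambda>y. \<Sum>\<^sub>\<infinity>x. of_real (b y x) * g x"
  have "((\<lambda>x. ?d x * f x * cnj (g x)) has_sum (\<Sum>x\<in>S. ?d x * f x * cnj (g x))) UNIV"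
    using S by (intro has_sum_finite_neutralI) auto
  moreover have "((\<lambda>x. \<Sum>y\<in>S. - f y * cnj (of_real (b y x) * g x)) has_sum (\<Sum>y\<in>S. - f y * cnj (?N y))) UNIV"
    by (intro has_sum_finite_sum S has_sum_cmult_right iffD2[OF has_sum_cnj_iff] has_sum_infsum
        neighbour_sum_summable g)
  ultimately have "((\<lambda>x. ?d x * f x * cnj (g x) + (\<Sum>y\<in>S. - f y * cnj (of_real (b y x) * g x)))
      has_sum (\<Sum>x\<in>S. ?d x * f x * cnj (g x)) + (\<Sum>y\<in>S. - f y * cnj (?N y))) UNIV"
    by (rule has_sum_add)
  also have "(\<lambda>x. ?d x * f x * cnj (g x) + (\<Sum>y\<in>S. - f y * cnj (of_real (b y x) * g x))) =
      (\<lambda>x. of_real (\<mu> x) * \<L> f x * cnj (g x))"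
  proof
    fix x
    have "(\<Sum>y\<in>S. - f y * cnj (of_real (b y x) * g x)) = - (\<Sum>y\<in>S. of_real (b x y) * f y) * cnj (g x)"
      unfolding minus_mult_left[symmetric] sum_negf sum_distrib_right
      by (simp add: edge_symmetric[of x] mult_ac)
    then show "?d x * f x * cnj (g x) + (\<Sum>y\<in>S. - f y * cnj (of_real (b y x) * g x)) =
        of_real (\<mu> x) * \<L> f x * cnj (g x)"
      unfolding schroedinger_degree_form[OF finitely_supported_formal_domain[OF f]] N
      by (simp add: left_diff_distrib)
  qed
  also have "(\<Sum>x\<in>S. ?d x * f x * cnj (g x)) + (\<Sum>y\<in>S. - f y * cnj (?N y)) =
      (\<Sum>x\<in>S. f x * cnj (?d x * g x - ?N x))"
    by (simp add: sum.distrib[symmetric] algebra_simps)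
  also have "\<dots> = (\<Sum>x\<in>S. of_real (\<mu> x) * f x * cnj (\<L> g x))"
    unfolding schroedinger_degree_form[OF g, symmetric] by (simp add: mult_ac)
  also have "\<dots> = ell2_inner \<mu> f (\<L> g)"
    unfolding ell2_inner_def using S by (intro infsumI[symmetric] has_sum_finite_neutralI) auto
  finally show ?thesis
    unfolding ell2_inner_def[of \<mu> "\<L> f"] by (rule infsumI)
qed

abbreviation "\<L>\<^sub>c \<equiv> restrict_operator (schroedinger b \<mu> V) finitely_supported"

lemma minimal_operator_eq: "\<L>\<^sub>c = {(f, \<L> f) | f. f \<in> finitely_supported}"
  using finitely_supported_formal_domain by (auto simp: restrict_operator_def schroedinger_eq)

lemma finitely_supported_add:
  "f \<in> finitely_supported \<Longrightarrow> g \<in> finitely_supported \<Longrightarrow> (\<lambda>x. f x + g x) \<in> finitely_supported"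
  unfolding finitely_supported_def
  by (auto intro: finite_subset[of _ "{x. f x \<noteq> 0} \<union> {x. g x \<noteq> 0}"])

lemma finitely_supported_scale:
  "f \<in> finitely_supported \<Longrightarrow> (\<lambda>x. c * f x) \<in> finitely_supported"
  unfolding finitely_supported_def by (auto elim: rev_finite_subset)

lemma schroedinger_add:
  assumes "f \<in> formal_domain b" "g \<in> formal_domain b"
  shows "\<L> (\<lambda>x. f x + g x) = (\<lambda>x. \<L> f x + \<L> g x)"
proof
  fix x
  have "(\<Sum>\<^sub>\<infinity>y. of_real (b x y) * (f x + g x - (f y + g y))) =
      (\<Sum>\<^sub>\<infinity>y. of_real (b x y) * (f x - f y)) + (\<Sum>\<^sub>\<infinity>y. of_real (b x y) * (g x - g y))"
    using infsum_add[OF has_sum_imp_summable[OF laplacian_has_sum[OF assms(1)]]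
        has_sum_imp_summable[OF laplacian_has_sum[OF assms(2)]], of x x]
    by (simp add: algebra_simps)
  then show "\<L> (\<lambda>x. f x + g x) x = \<L> f x + \<L> g x"
    by (simp add: formal_schroedinger_def algebra_simps add_divide_distrib)
qed

lemma schroedinger_scale: "\<L> (\<lambda>x. c * f x) = (\<lambda>x. c * \<L> f x)"
proof
  fix x
  have "(\<Sum>\<^sub>\<infinity>y. of_real (b x y) * (c * f x - c * f y)) = c * (\<Sum>\<^sub>\<infinity>y. of_real (b x y) * (f x - f y))"
    unfolding infsum_cmult_right'[symmetric] by (simp add: algebra_simps)
  then show "\<L> (\<lambda>x. c * f x) x = c * \<L> f x"
    by (simp add: formal_schroedinger_def algebra_simps)
qed

lemma minimal_operator: "ell2_operator \<mu> \<L>\<^sub>c"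
  unfolding ell2_operator_def minimal_operator_eq
proof (intro conjI allI impI)
  show "{(f, \<L> f) |f. f \<in> finitely_supported} \<subseteq> ell2 \<mu> \<times> ell2 \<mu>"
    using finitely_supported_subset_ell2[of \<mu>, OF weight_pos] schroedinger_finitely_supported_ell2 by auto
  show "single_valued {(f, \<L> f) |f. f \<in> finitely_supported}"
    by (auto simp: single_valued_def)
  have "(\<lambda>x. 0) \<in> finitely_supported" "\<L> (\<lambda>x. 0) = (\<lambda>x. 0)"
    by (auto simp: finitely_supported_def formal_schroedinger_def)
  then show "((\<lambda>x. 0), (\<lambda>x. 0)) \<in> {(f, \<L> f) |f. f \<in> finitely_supported}"
    by force
qed (auto simp: finitely_supported_add finitely_supported_scale schroedinger_add schroedinger_scale
    finitely_supported_formal_domain)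

lemma finitely_supported_dense:
  assumes f: "f \<in> ell2 \<mu>" and e: "0 < e"
  obtains g where "g \<in> finitely_supported" "ell2_norm \<mu> (\<lambda>x. f x - g x) < e"
proof -
  let ?a = "\<lambda>x. \<mu> x * (cmod (f x))\<^sup>2"
  have a: "?a summable_on UNIV"
    using f by (simp add: ell2_def)
  have "0 < e\<^sup>2 / 2"
    using e by simp
  from infsum_finite_approximation[OF a this] obtain S where
    S: "finite S" "dist (sum ?a S) (infsum ?a UNIV) \<le> e\<^sup>2 / 2"
    by blast
  let ?g = "\<lambda>x. if x \<in> S then f x else 0"
  have g: "?g \<in> finitely_supported"
    using S(1) by (auto simp: finitely_supported_def)
  have "((\<lambda>x. ?a x + (if x \<in> S then - ?a x else 0)) has_sum
      infsum ?a UNIV + (\<Sum>x\<in>S. if x \<in> S then - ?a x else 0)) UNIV"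
    using S(1) by (intro has_sum_add has_sum_infsum a has_sum_finite_neutralI) auto
  moreover have "(\<Sum>x\<in>S. if x \<in> S then - ?a x else 0) = - sum ?a S"
    by (simp add: sum_negf)
  moreover have "?a x + (if x \<in> S then - ?a x else 0) = \<mu> x * (cmod (f x - ?g x))\<^sup>2" for x
    by simp
  ultimately have "(ell2_norm \<mu> (\<lambda>x. f x - ?g x))\<^sup>2 = infsum ?a UNIV - sum ?a S"
    unfolding ell2_norm_square[OF weight_pos] by (intro infsumI) simp
  also have "\<dots> \<le> e\<^sup>2 / 2"
    using S(2) unfolding dist_real_def by linarith
  also have "\<dots> < e\<^sup>2"
    using e by simp
  finally have "ell2_norm \<mu> (\<lambda>x. f x - ?g x) < e"
    using e by (simp add: power_less_imp_less_base[of _ 2])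
  with g show ?thesis
    by (rule that)
qed

lemma minimal_operator_dense: "densely_defined \<mu> \<L>\<^sub>c"
  unfolding densely_defined_def
proof (intro ballI allI impI)
  fix f :: "'v \<Rightarrow> complex" and e :: real assume "f \<in> ell2 \<mu>" "0 < e"
  then obtain g where "g \<in> finitely_supported" "ell2_norm \<mu> (\<lambda>x. f x - g x) < e"
    by (rule finitely_supported_dense)
  then show "\<exists>g\<in>Domain \<L>\<^sub>c. ell2_norm \<mu> (\<lambda>x. f x - g x) < e"
    unfolding minimal_operator_eq by (intro bexI[of _ g]) auto
qed

lemma minimal_operator_symmetric: "symmetric_operator \<mu> \<L>\<^sub>c"
  unfolding symmetric_operator_def minimal_operator_eq
  by (auto intro: green_formula finitely_supported_formal_domain)

text \<open>
  Testing the defining identity of the adjoint against the point mass at \<open>x\<close>.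
\<close>
lemma adjoint_acts_formally:
  assumes "(g, h) \<in> operator_adjoint \<mu> \<L>\<^sub>c"
  shows "h = \<L> g"
proof
  fix x
  have g: "g \<in> formal_domain b"
    using assms ell2_subset_formal_domain by (auto simp: operator_adjoint_def)
  let ?\<delta> = "\<lambda>y::'v. if y = x then 1 else 0 :: complex"
  have \<delta>: "?\<delta> \<in> finitely_supported"
    by (simp add: finitely_supported_def)
  have \<delta>_inner: "ell2_inner \<mu> ?\<delta> k = of_real (\<mu> x) * cnj (k x)" for k
    unfolding ell2_inner_def by (intro infsumI has_sum_finite_neutralI[of "{x}"]) auto
  have "(?\<delta>, \<L> ?\<delta>) \<in> \<L>\<^sub>c"
    using \<delta> by (auto simp: minimal_operator_eq)
  then have "ell2_inner \<mu> (\<L> ?\<delta>) g = ell2_inner \<mu> ?\<delta> h"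
    using assms unfolding operator_adjoint_def by blast
  then have "of_real (\<mu> x) * cnj (\<L> g x) = of_real (\<mu> x) * cnj (h x)"
    unfolding green_formula[OF \<delta> g] \<delta>_inner .
  then show "h x = \<L> g x"
    using weight_pos[of x] by simp
qed

end

end

end

section \<open>Eigenfunctions for nonreal eigenvalues\<close>

lemma jump_size_finiteD:
  assumes "jump_size b \<rho> < \<infinity>"
  obtains s where "0 \<le> s" "\<And>x y. adjacent b x y \<Longrightarrow> \<rho> x y \<le> s"
proof
  show "0 \<le> enn2real (jump_size b \<rho>)"
    by simp
  fix x y assume "adjacent b x y"
  then have "ennreal (\<rho> x y) \<le> jump_size b \<rho>"
    unfolding jump_size_def by (intro Sup_upper) auto
  then have "ennreal (\<rho> x y) \<le> ennreal (enn2real (jump_size b \<rho>))"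
    using assms by simp
  then show "\<rho> x y \<le> enn2real (jump_size b \<rho>)"
    by simp
qed

lemma weighted_young:
  fixes u v t :: real
  assumes t: "0 < t"
  shows "u * v \<le> t / 2 * u\<^sup>2 + v\<^sup>2 / (2 * t)"
proof -
  have "0 \<le> (t * u - v)\<^sup>2 / (2 * t)"
    using t by simp
  also have "\<dots> = t / 2 * u\<^sup>2 + v\<^sup>2 / (2 * t) - u * v"
    using t by (simp add: power2_eq_square field_simps)
  finally show ?thesis
    by simp
qed

lemma clamp_Lipschitz: "\<bar>max 0 (min 1 u) - max 0 (min 1 v)\<bar> \<le> \<bar>u - v\<bar>" for u v :: real
  by (simp add: max_def min_def)

context
  fixes b :: "'v::countable \<Rightarrow> 'v \<Rightarrow> real" and \<mu> V :: "'v \<Rightarrow> real" and \<rho> :: "'v \<Rightarrow> 'v \<Rightarrow> real"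
    and p :: 'v and b1 b2 s :: real and \<zeta> :: complex and w :: "'v \<Rightarrow> complex"
  assumes graph: "weighted_graph b"
    and weight_pos: "\<And>x. 0 < \<mu> x"
    and pseudo_metric: "pseudo_metric \<rho>"
    and intrinsic: "intrinsic b \<mu> \<rho>"
    and degree_bounded: "\<And>r. 0 \<le> r \<Longrightarrow> bounded (weighted_degree b \<mu> ` pm_ball \<rho> p r)"
    and s_nonneg: "0 \<le> s" and jump: "\<And>x y. adjacent b x y \<Longrightarrow> \<rho> x y \<le> s"
    and b1: "0 \<le> b1" and b2: "0 \<le> b2"
    and potential: "\<And>x. - b1 - b2 * (\<rho> p x)\<^sup>2 \<le> V x"
    and w_ell2: "w \<in> ell2 \<mu>" and w_formal: "w \<in> formal_domain b"
    and eigen: "\<And>x. formal_schroedinger b \<mu> V w x = \<zeta> * w x"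
begin

abbreviation "mass x \<equiv> \<mu> x * (cmod (w x))\<^sup>2"
abbreviation "total_mass \<equiv> (\<Sum>\<^sub>\<infinity>x. mass x)"

lemma mass_summable: "mass summable_on UNIV"
  using w_ell2 by (simp add: ell2_def)

lemma mass_nonneg: "0 \<le> mass x"
  using weight_pos[of x] by simp

lemma cutoff_mass_summable:
  assumes "\<And>x. 0 \<le> \<phi> x" "\<And>x. \<phi> x \<le> 1"
  shows "(\<lambda>x. (\<phi> x)\<^sup>2 * mass x) summable_on UNIV"
proof (rule summable_on_comparison_test[OF mass_summable])
  show "(\<phi> x)\<^sup>2 * mass x \<le> mass x" for x
    using assms by (intro mult_left_le_one_le mass_nonneg power_le_one) auto
  show "0 \<le> (\<phi> x)\<^sup>2 * mass x" for x
    by (intro mult_nonneg_nonneg mass_nonneg) simp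
qed

lemma mass_on_summable: "(\<lambda>x. if x \<in> N then mass x else 0) summable_on UNIV"
  using mass_summable by (rule summable_on_comparison_test) (auto simp: mass_nonneg)

lemma distance_step:
  assumes "0 < b x y"
  shows "\<rho> p y \<le> \<rho> p x + s"
proof -
  have "\<rho> p y \<le> \<rho> p x + \<rho> x y"
    using pseudo_metric by (auto simp: pseudo_metric_def)
  then show ?thesis
    using jump[of x y] assms by (simp add: adjacent_def)
qed

text \<open>
  On a ball the degree is bounded, so \<open>\<Sum>\<^sub>y b x y\<close> is at most a multiple of \<open>\<mu> x\<close> there. The ball may
  contain infinitely many vertices with infinitely many neighbours each; this estimate is what makes
  all the double series below converge absolutely.
\<close>
lemma ball_edge_mass_summable:
  assumes "0 \<le> R"
  shows "(\<lambda>(x, y). b x y * (if \<rho> p x \<le> R then (cmod (w x))\<^sup>2 else 0)) summable_on UNIV"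
proof -
  obtain M where M: "\<And>x. \<rho> p x \<le> R \<Longrightarrow> \<bar>weighted_degree b \<mu> x\<bar> \<le> M"
    using degree_bounded[OF assms] by (auto simp: bounded_iff pm_ball_def)
  let ?u = "\<lambda>x. if \<rho> p x \<le> R then (cmod (w x))\<^sup>2 else 0"
  have "(\<lambda>(x, y). b x y * ?u x) summable_on UNIV \<times> UNIV"
  proof (rule summable_on_SigmaI)
    show "((\<lambda>y. case (x, y) of (x, y) \<Rightarrow> b x y * ?u x) has_sum (\<Sum>\<^sub>\<infinity>y. b x y) * ?u x) UNIV" for x
      using edge_summable[OF graph, of x] by (auto intro!: has_sum_cmult_left)
    show "(\<lambda>x. (\<Sum>\<^sub>\<infinity>y. b x y) * ?u x) summable_on UNIV"
    proof (rule summable_on_comparison_test)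
      show "(\<lambda>x. M * mass x) summable_on UNIV"
        by (intro summable_on_cmult_right mass_summable)
    next
      fix x
      have deg: "(\<Sum>\<^sub>\<infinity>y. b x y) = weighted_degree b \<mu> x * \<mu> x"
        using weight_pos[of x] by (simp add: weighted_degree_def)
      show "(\<Sum>\<^sub>\<infinity>y. b x y) * ?u x \<le> M * mass x"
      proof (cases "\<rho> p x \<le> R")
        case True
        then have "weighted_degree b \<mu> x * mass x \<le> M * mass x"
          using M[OF True] by (intro mult_right_mono mass_nonneg) auto
        then show ?thesis
          using True unfolding deg by (simp add: mult.assoc)
      next
        case False
        have "\<rho> p p \<le> R"
          using pseudo_metric assms by (simp add: pseudo_metric_def)
        from M[OF this] have "0 \<le> M" by linarith
        then show ?thesis
          using False mass_nonneg[of x] by simp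
      qed
      show "0 \<le> (\<Sum>\<^sub>\<infinity>y. b x y) * ?u x"
        by (intro mult_nonneg_nonneg infsum_nonneg edge_nonneg[OF graph]) auto
    qed
  qed (auto intro!: mult_nonneg_nonneg edge_nonneg[OF graph])
  then show ?thesis by simp
qed

text \<open>
  A cutoff \<open>\<phi>\<close> is fixed that is \<open>\<kappa>\<close>-Lipschitz and supported in the ball of radius \<open>R\<close>; \<open>N\<close>
  contains every vertex across one of whose edges \<open>\<phi>\<close> changes.
\<close>
context
  fixes \<phi> :: "'v \<Rightarrow> real" and \<kappa> R :: real and N :: "'v set"
  assumes cutoff_ge: "\<And>x. 0 \<le> \<phi> x" and cutoff_le: "\<And>x. \<phi> x \<le> 1"
    and cutoff_Lipschitz: "\<And>x y. \<bar>\<phi> x - \<phi> y\<bar> \<le> \<kappa> * \<rho> x y"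
    and R: "0 \<le> R" and cutoff_support: "\<And>x. \<phi> x \<noteq> 0 \<Longrightarrow> \<rho> p x \<le> R"
    and cutoff_varies: "\<And>x y. 0 < b x y \<Longrightarrow> \<phi> x \<noteq> \<phi> y \<Longrightarrow> x \<in> N"
begin

text \<open>
  The radius is \<open>R + s\<close> because an edge that meets the support of \<open>\<phi>\<close> may leave the ball of
  radius \<open>R\<close>, but by no more than the jump size.
\<close>
abbreviation "edge_mass x y \<equiv> b x y * (if \<rho> p x \<le> R + s then (cmod (w x))\<^sup>2 else 0)"

lemma edge_mass_summable:
  "(\<lambda>(x, y). edge_mass x y) summable_on UNIV" "(\<lambda>(x, y). edge_mass y x) summable_on UNIV"
proof -
  show "(\<lambda>(x, y). edge_mass x y) summable_on UNIV"
    using R s_nonneg by (intro ball_edge_mass_summable) simp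
  then show "(\<lambda>(x, y). edge_mass y x) summable_on UNIV"
    using summable_on_swap[of "\<lambda>(x, y). edge_mass x y" UNIV UNIV]
    by (simp only: UNIV_Times_UNIV prod.case)
qed

lemma edge_mass_eq:
  assumes "0 < b x y" "\<phi> x \<noteq> 0 \<or> \<phi> y \<noteq> 0"
  shows "edge_mass x y = b x y * (cmod (w x))\<^sup>2" "edge_mass y x = b x y * (cmod (w y))\<^sup>2"
proof -
  have sym: "b y x = b x y"
    by (rule edge_symmetric[OF graph])
  have "\<rho> p x \<le> R \<or> \<rho> p y \<le> R"
    using assms(2) cutoff_support by blast
  then have "\<rho> p x \<le> R + s" "\<rho> p y \<le> R + s"
    using distance_step[of x y] distance_step[of y x] assms(1) s_nonneg sym by auto
  then show "edge_mass x y = b x y * (cmod (w x))\<^sup>2" "edge_mass y x = b x y * (cmod (w y))\<^sup>2"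
    by (simp_all add: sym)
qed

lemma dominated_summable:
  fixes F :: "'v \<Rightarrow> 'v \<Rightarrow> 'c::banach"
  assumes "\<And>x y. 0 < b x y \<Longrightarrow> \<phi> x \<noteq> 0 \<or> \<phi> y \<noteq> 0 \<Longrightarrow>
      norm (F x y) \<le> c * (b x y * (cmod (w x))\<^sup>2 + b x y * (cmod (w y))\<^sup>2)"
    and "\<And>x y. b x y = 0 \<or> \<phi> x = 0 \<and> \<phi> y = 0 \<Longrightarrow> F x y = 0"
    and "0 \<le> c"
  shows "(\<lambda>(x, y). F x y) summable_on UNIV"
proof (rule abs_summable_summable)
  have "(\<lambda>z. c * ((\<lambda>(x, y). edge_mass x y) z + (\<lambda>(x, y). edge_mass y x) z)) summable_on UNIV"
    by (intro summable_on_cmult_right summable_on_add edge_mass_summable)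
  then show "(\<lambda>z. norm ((\<lambda>(x, y). F x y) z)) summable_on UNIV"
  proof (rule Infinite_Sum.abs_summable_on_comparison_test')
    fix z :: "'v \<times> 'v"
    obtain x y where z: "z = (x, y)" by fastforce
    have "norm (F x y) \<le> c * (edge_mass x y + edge_mass y x)"
    proof (cases "0 < b x y \<and> (\<phi> x \<noteq> 0 \<or> \<phi> y \<noteq> 0)")
      case True
      then show ?thesis
        using assms(1)[of x y] edge_mass_eq[of x y] by (metis (no_types, lifting))
    next
      case False
      then have "b x y = 0 \<or> \<phi> x = 0 \<and> \<phi> y = 0"
        using edge_nonneg[OF graph, of x y] by auto
      then have "F x y = 0"
        by (rule assms(2))
      then show ?thesis
        using assms(3) by (simp add: edge_nonneg[OF graph])
    qed
    then show "norm ((\<lambda>(x, y). F x y) z) \<le> c * ((\<lambda>(x, y). edge_mass x y) z + (\<lambda>(x, y). edge_mass y x) z)"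
      by (simp add: z)
  qed
qed

lemma cutoff_square_le: "(\<phi> x)\<^sup>2 \<le> 1"
  using cutoff_ge cutoff_le by (simp add: power_le_one)

abbreviation "flux x y \<equiv> of_real (b x y * (\<phi> x)\<^sup>2) * cnj (w x) * (w x - w y)"

lemma flux_summable: "(\<lambda>(x, y). flux x y) summable_on UNIV"
proof (rule dominated_summable)
  fix x y assume b: "0 < b x y"
  have "cmod (w x) * cmod (w x - w y) \<le> cmod (w x) * (cmod (w x) + cmod (w y))"
    by (intro mult_left_mono norm_triangle_ineq4) simp
  also have "\<dots> \<le> 2 * ((cmod (w x))\<^sup>2 + (cmod (w y))\<^sup>2)"
    using sum_squares_bound[of "cmod (w x)" "cmod (w y)"]
      zero_le_square[of "cmod (w x)"] zero_le_square[of "cmod (w y)"]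
    unfolding distrib_left power2_eq_square by linarith
  finally have *: "cmod (w x) * cmod (w x - w y) \<le> 2 * ((cmod (w x))\<^sup>2 + (cmod (w y))\<^sup>2)" .
  have "cmod (flux x y) = b x y * ((\<phi> x)\<^sup>2 * (cmod (w x) * cmod (w x - w y)))"
    using b by (simp add: norm_mult norm_power abs_of_pos mult.assoc)
  also have "\<dots> \<le> b x y * (1 * (2 * ((cmod (w x))\<^sup>2 + (cmod (w y))\<^sup>2)))"
    using b by (intro mult_left_mono mult_mono[OF cutoff_square_le *]) auto
  finally show "cmod (flux x y) \<le> 2 * (b x y * (cmod (w x))\<^sup>2 + b x y * (cmod (w y))\<^sup>2)"
    by (simp add: algebra_simps)
qed auto

abbreviation "total_flux \<equiv> infsum (\<lambda>(x, y). flux x y) UNIV"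

text \<open>
  Summation over \<open>y\<close> first, where the eigenvalue equation replaces the Laplacian by a
  multiplication. The total flux thus carries \<open>Im \<zeta>\<close> in its imaginary part and the potential in its
  real part.
\<close>
lemma flux_has_sum:
  "((\<lambda>x. of_real ((\<phi> x)\<^sup>2 * mass x) * (\<zeta> - of_real (V x))) has_sum total_flux) UNIV"
proof (rule has_sum_SigmaD)
  show "((\<lambda>(x, y). flux x y) has_sum total_flux) (UNIV \<times> UNIV)"
    using flux_summable by simp
  fix x
  have "((\<lambda>y. of_real (b x y) * (w x - w y)) has_sum of_real (\<mu> x) * ((\<zeta> - of_real (V x)) * w x)) UNIV"
    using laplacian_has_sum[where \<mu> = \<mu> and V = V and x = x, OF graph weight_pos w_formal]
    by (simp add: eigen left_diff_distrib)
  then have "((\<lambda>y. (of_real ((\<phi> x)\<^sup>2) * cnj (w x)) * (of_real (b x y) * (w x - w y))) has_sum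
      (of_real ((\<phi> x)\<^sup>2) * cnj (w x)) * (of_real (\<mu> x) * ((\<zeta> - of_real (V x)) * w x))) UNIV"
    by (rule has_sum_cmult_right)
  moreover have "(of_real ((\<phi> x)\<^sup>2) * cnj (w x)) * (of_real (\<mu> x) * ((\<zeta> - of_real (V x)) * w x)) =
      of_real ((\<phi> x)\<^sup>2 * mass x) * (\<zeta> - of_real (V x))"
    unfolding of_real_mult complex_norm_square by (simp only: mult_ac)
  moreover have "(of_real ((\<phi> x)\<^sup>2) * cnj (w x)) * (of_real (b x y) * (w x - w y)) = flux x y" for y
    unfolding of_real_mult by (simp only: mult_ac)
  ultimately show "((\<lambda>y. (\<lambda>(x, y). flux x y) (x, y)) has_sum
      of_real ((\<phi> x)\<^sup>2 * mass x) * (\<zeta> - of_real (V x))) UNIV"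
    by (simp only: prod.case)
qed

abbreviation "cutoff_mass \<equiv> (\<Sum>\<^sub>\<infinity>x. (\<phi> x)\<^sup>2 * mass x)"

lemma Im_total_flux: "Im total_flux = Im \<zeta> * cutoff_mass"
proof (rule has_sum_unique)
  show "((\<lambda>x. Im \<zeta> * ((\<phi> x)\<^sup>2 * mass x)) has_sum Im total_flux) UNIV"
    using has_sum_Im[OF flux_has_sum] by (simp add: mult_ac)
  show "((\<lambda>x. Im \<zeta> * ((\<phi> x)\<^sup>2 * mass x)) has_sum Im \<zeta> * cutoff_mass) UNIV"
    by (intro has_sum_cmult_right has_sum_infsum
        cutoff_mass_summable[OF cutoff_ge cutoff_le])
qed

lemma Re_total_flux_le: "Re total_flux \<le> (cmod \<zeta> + b1 + b2 * R\<^sup>2) * total_mass"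
proof (rule has_sum_mono)
  show "((\<lambda>x. (\<phi> x)\<^sup>2 * mass x * (Re \<zeta> - V x)) has_sum Re total_flux) UNIV"
    using has_sum_Re[OF flux_has_sum] by simp
  show "((\<lambda>x. (cmod \<zeta> + b1 + b2 * R\<^sup>2) * mass x) has_sum (cmod \<zeta> + b1 + b2 * R\<^sup>2) * total_mass) UNIV"
    by (intro has_sum_cmult_right has_sum_infsum mass_summable)
  fix x
  have C: "0 \<le> cmod \<zeta> + b1 + b2 * R\<^sup>2"
    using b1 b2 by simp
  show "(\<phi> x)\<^sup>2 * mass x * (Re \<zeta> - V x) \<le> (cmod \<zeta> + b1 + b2 * R\<^sup>2) * mass x"
  proof (cases "\<phi> x = 0")
    case True
    then show ?thesis
      using C mass_nonneg[of x] by simp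
  next
    case False
    have "0 \<le> \<rho> p x"
      using pseudo_metric by (simp add: pseudo_metric_def)
    then have "(\<rho> p x)\<^sup>2 \<le> R\<^sup>2"
      using cutoff_support[OF False] by (intro power_mono)
    then have "Re \<zeta> - V x \<le> cmod \<zeta> + b1 + b2 * R\<^sup>2"
      using potential[of x] mult_left_mono[OF _ b2, of "(\<rho> p x)\<^sup>2" "R\<^sup>2"] complex_Re_le_cmod[of \<zeta>] by simp
    then have "(\<phi> x)\<^sup>2 * mass x * (Re \<zeta> - V x) \<le> (\<phi> x)\<^sup>2 * mass x * (cmod \<zeta> + b1 + b2 * R\<^sup>2)"
      by (intro mult_left_mono mult_nonneg_nonneg mass_nonneg) auto
    also have "\<dots> \<le> 1 * mass x * (cmod \<zeta> + b1 + b2 * R\<^sup>2)"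
      using C by (intro mult_right_mono cutoff_square_le mass_nonneg)
    finally show ?thesis
      by (simp add: mult.commute)
  qed
qed

abbreviation "energy x y \<equiv> b x y * ((\<phi> x)\<^sup>2 + (\<phi> y)\<^sup>2) * (cmod (w x - w y))\<^sup>2"
abbreviation "total_energy \<equiv> infsum (\<lambda>(x, y). energy x y) UNIV"

lemma energy_summable: "(\<lambda>(x, y). energy x y) summable_on UNIV"
proof (rule dominated_summable)
  fix x y assume b: "0 < b x y"
  have "energy x y = b x y * (((\<phi> x)\<^sup>2 + (\<phi> y)\<^sup>2) * (cmod (w x - w y))\<^sup>2)"
    by (simp add: mult.assoc)
  also have "\<dots> \<le> b x y * ((1 + 1) * (2 * (cmod (w x))\<^sup>2 + 2 * (cmod (w y))\<^sup>2))"
    using b norm_add_square_le[of "w x" "- w y"]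
    by (intro mult_left_mono mult_mono add_mono cutoff_square_le) auto
  finally have "energy x y \<le> 4 * (b x y * (cmod (w x))\<^sup>2 + b x y * (cmod (w y))\<^sup>2)"
    by (simp add: algebra_simps)
  moreover have "0 \<le> energy x y"
    using b by simp
  ultimately show "norm (energy x y) \<le> 4 * (b x y * (cmod (w x))\<^sup>2 + b x y * (cmod (w y))\<^sup>2)"
    by simp
qed auto

abbreviation "variation x y \<equiv> b x y * (\<phi> x - \<phi> y)\<^sup>2 * ((cmod (w x))\<^sup>2 + (cmod (w y))\<^sup>2)"
abbreviation "tail_mass \<equiv> (\<Sum>\<^sub>\<infinity>x. if x \<in> N then mass x else 0)"

lemma cutoff_diff_square_le: "(\<phi> x - \<phi> y)\<^sup>2 \<le> 1"
  using cutoff_ge[of x] cutoff_ge[of y] cutoff_le[of x] cutoff_le[of y]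
  by (simp add: abs_square_le_1 abs_le_iff)

lemma half_variation_summable:
  "(\<lambda>(x, y). b x y * (\<phi> x - \<phi> y)\<^sup>2 * (cmod (w x))\<^sup>2) summable_on UNIV"
proof (rule dominated_summable)
  fix x y assume b: "0 < b x y"
  have "b x y * (\<phi> x - \<phi> y)\<^sup>2 * (cmod (w x))\<^sup>2 \<le> b x y * 1 * (cmod (w x))\<^sup>2"
    using b by (intro mult_right_mono mult_left_mono cutoff_diff_square_le) auto
  also have "\<dots> \<le> 1 * (b x y * (cmod (w x))\<^sup>2 + b x y * (cmod (w y))\<^sup>2)"
    using b by simp
  finally show "norm (b x y * (\<phi> x - \<phi> y)\<^sup>2 * (cmod (w x))\<^sup>2) \<le>
      1 * (b x y * (cmod (w x))\<^sup>2 + b x y * (cmod (w y))\<^sup>2)"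
    using b by simp
qed auto

text \<open>
  This is the point where the metric being intrinsic enters: it turns the Lipschitz bound of \<open>\<phi>\<close>
  into \<open>\<Sum>\<^sub>y b x y (\<phi> x - \<phi> y)\<^sup>2 \<le> \<kappa>\<^sup>2 \<mu> x\<close>, however large the degree of \<open>x\<close> is.
\<close>
lemma half_variation_le:
  "infsum (\<lambda>(x, y). b x y * (\<phi> x - \<phi> y)\<^sup>2 * (cmod (w x))\<^sup>2) UNIV \<le> \<kappa>\<^sup>2 * tail_mass"
proof (rule has_sum_mono)
  have edge_sum: "(\<lambda>y. b x y * (\<phi> x - \<phi> y)\<^sup>2) summable_on UNIV" for x
    using edge_summable[OF graph, of x]
  proof (rule summable_on_comparison_test)
    show "b x y * (\<phi> x - \<phi> y)\<^sup>2 \<le> b x y" for y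
      using mult_left_mono[OF cutoff_diff_square_le edge_nonneg[OF graph, of x y]] by simp
    show "0 \<le> b x y * (\<phi> x - \<phi> y)\<^sup>2" for y
      by (simp add: edge_nonneg[OF graph])
  qed
  show "((\<lambda>x. (\<Sum>\<^sub>\<infinity>y. b x y * (\<phi> x - \<phi> y)\<^sup>2) * (cmod (w x))\<^sup>2) has_sum
      infsum (\<lambda>(x, y). b x y * (\<phi> x - \<phi> y)\<^sup>2 * (cmod (w x))\<^sup>2) UNIV) UNIV"
  proof (rule has_sum_SigmaD)
    show "((\<lambda>(x, y). b x y * (\<phi> x - \<phi> y)\<^sup>2 * (cmod (w x))\<^sup>2) has_sum
      infsum (\<lambda>(x, y). b x y * (\<phi> x - \<phi> y)\<^sup>2 * (cmod (w x))\<^sup>2) UNIV) (UNIV \<times> UNIV)"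
      using half_variation_summable by simp
    show "((\<lambda>y. (\<lambda>(x, y). b x y * (\<phi> x - \<phi> y)\<^sup>2 * (cmod (w x))\<^sup>2) (x, y)) has_sum
        (\<Sum>\<^sub>\<infinity>y. b x y * (\<phi> x - \<phi> y)\<^sup>2) * (cmod (w x))\<^sup>2) UNIV" for x
      unfolding prod.case by (intro has_sum_cmult_left has_sum_infsum edge_sum)
  qed
  show "((\<lambda>x. \<kappa>\<^sup>2 * (if x \<in> N then mass x else 0)) has_sum \<kappa>\<^sup>2 * tail_mass) UNIV"
    by (intro has_sum_cmult_right has_sum_infsum mass_on_summable)
  fix x
  have "(\<Sum>\<^sub>\<infinity>y. b x y * (\<phi> x - \<phi> y)\<^sup>2) \<le> \<kappa>\<^sup>2 * (if x \<in> N then \<mu> x else 0)"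
  proof (cases "x \<in> N")
    case True
    have intr: "(\<lambda>y. b x y * (\<rho> x y)\<^sup>2) summable_on UNIV" "(\<Sum>\<^sub>\<infinity>y. b x y * (\<rho> x y)\<^sup>2) \<le> \<mu> x"
      using intrinsic by (auto simp: intrinsic_def)
    have "(\<Sum>\<^sub>\<infinity>y. b x y * (\<phi> x - \<phi> y)\<^sup>2) \<le> (\<Sum>\<^sub>\<infinity>y. \<kappa>\<^sup>2 * (b x y * (\<rho> x y)\<^sup>2))"
    proof (intro infsum_mono edge_sum summable_on_cmult_right intr)
      fix y
      have "\<bar>\<phi> x - \<phi> y\<bar>\<^sup>2 \<le> (\<kappa> * \<rho> x y)\<^sup>2"
        by (intro power_mono cutoff_Lipschitz) simp
      then have "b x y * (\<phi> x - \<phi> y)\<^sup>2 \<le> b x y * (\<kappa> * \<rho> x y)\<^sup>2"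
        by (intro mult_left_mono edge_nonneg[OF graph]) simp
      then show "b x y * (\<phi> x - \<phi> y)\<^sup>2 \<le> \<kappa>\<^sup>2 * (b x y * (\<rho> x y)\<^sup>2)"
        by (simp add: power_mult_distrib mult_ac)
    qed
    also have "\<dots> \<le> \<kappa>\<^sup>2 * \<mu> x"
      unfolding infsum_cmult_right' by (intro mult_left_mono intr) simp
    finally show ?thesis
      using True by simp
  next
    case False
    then have "b x y * (\<phi> x - \<phi> y)\<^sup>2 = 0" for y
      using cutoff_varies[of x y] edge_nonneg[OF graph, of x y] by force
    then have "(\<Sum>\<^sub>\<infinity>y. b x y * (\<phi> x - \<phi> y)\<^sup>2) = 0"
      by (intro infsum_0)
    then show ?thesis
      using False by simp
  qed
  then have "(\<Sum>\<^sub>\<infinity>y. b x y * (\<phi> x - \<phi> y)\<^sup>2) * (cmod (w x))\<^sup>2 \<le>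
      \<kappa>\<^sup>2 * (if x \<in> N then \<mu> x else 0) * (cmod (w x))\<^sup>2"
    by (intro mult_right_mono) auto
  then show "(\<Sum>\<^sub>\<infinity>y. b x y * (\<phi> x - \<phi> y)\<^sup>2) * (cmod (w x))\<^sup>2 \<le> \<kappa>\<^sup>2 * (if x \<in> N then mass x else 0)"
    by (simp split: if_splits)
qed

lemma variation_has_sum:
  obtains Q where "((\<lambda>(x, y). variation x y) has_sum Q) UNIV" "Q \<le> 2 * \<kappa>\<^sup>2 * tail_mass"
proof
  let ?h = "\<lambda>x y. b x y * (\<phi> x - \<phi> y)\<^sup>2 * (cmod (w x))\<^sup>2"
  let ?H = "infsum (\<lambda>(x, y). ?h x y) UNIV"
  have h: "((\<lambda>(x, y). ?h x y) has_sum ?H) UNIV"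
    using half_variation_summable by simp
  moreover have "((\<lambda>(x, y). ?h y x) has_sum ?H) UNIV"
    using h has_sum_swap[of "\<lambda>(x, y). ?h x y" UNIV UNIV ?H] by (simp only: UNIV_Times_UNIV prod.case)
  ultimately have "((\<lambda>z. (\<lambda>(x, y). ?h x y) z + (\<lambda>(x, y). ?h y x) z) has_sum ?H + ?H) UNIV"
    by (rule has_sum_add)
  moreover have "?h x y + ?h y x = variation x y" for x y
    unfolding edge_symmetric[OF graph, of y x] power2_commute[of "\<phi> y" "\<phi> x"]
    by (simp only: distrib_left)
  then have "(\<lambda>z. (\<lambda>(x, y). ?h x y) z + (\<lambda>(x, y). ?h y x) z) = (\<lambda>(x, y). variation x y)"
    by (intro ext) (simp only: split_paired_all prod.case)
  ultimately show "((\<lambda>(x, y). variation x y) has_sum ?H + ?H) UNIV"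
    by simp
  show "?H + ?H \<le> 2 * \<kappa>\<^sup>2 * tail_mass"
    using half_variation_le by simp
qed

text \<open>
  Symmetrising the flux in \<open>x\<close> and \<open>y\<close> and writing
  \<open>2 (\<phi>\<^sub>x\<^sup>2 u - \<phi>\<^sub>y\<^sup>2 v) = (\<phi>\<^sub>x\<^sup>2 + \<phi>\<^sub>y\<^sup>2) (u - v) + (\<phi>\<^sub>x\<^sup>2 - \<phi>\<^sub>y\<^sup>2) (u + v)\<close>
  splits it into the energy, which is real and nonnegative, and a cross term that only sees edges
  across which \<open>\<phi>\<close> changes.
\<close>
abbreviation "cross x y \<equiv>
  of_real (b x y * ((\<phi> x)\<^sup>2 - (\<phi> y)\<^sup>2)) * (w x - w y) * (cnj (w x) + cnj (w y))"

lemma four_flux: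
  "((\<lambda>(x, y). cross x y) has_sum 4 * total_flux - of_real total_energy) UNIV"
proof -
  have flux: "((\<lambda>(x, y). flux x y) has_sum total_flux) UNIV"
    using flux_summable by simp
  moreover have "((\<lambda>(x, y). flux y x) has_sum total_flux) UNIV"
    using flux has_sum_swap[of "\<lambda>(x, y). flux x y" UNIV UNIV total_flux] by (simp only: UNIV_Times_UNIV prod.case)
  moreover have "((\<lambda>z. complex_of_real ((\<lambda>(x, y). energy x y) z)) has_sum of_real total_energy) UNIV"
    by (intro has_sum_of_real has_sum_infsum energy_summable)
  ultimately have "((\<lambda>z. 2 * ((\<lambda>(x, y). flux x y) z + (\<lambda>(x, y). flux y x) z) +
      - 1 * of_real ((\<lambda>(x, y). energy x y) z)) has_sum
      2 * (total_flux + total_flux) + - 1 * of_real total_energy) UNIV"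
    by (intro has_sum_add has_sum_cmult_right)
  moreover have "2 * (flux x y + flux y x) + - 1 * of_real (energy x y) = cross x y" for x y
    unfolding edge_symmetric[OF graph, of y x] of_real_mult complex_norm_square
    by (simp add: algebra_simps)
  then have "(\<lambda>z. 2 * ((\<lambda>(x, y). flux x y) z + (\<lambda>(x, y). flux y x) z) +
      - 1 * of_real ((\<lambda>(x, y). energy x y) z)) = (\<lambda>(x, y). cross x y)"
    by (intro ext) (simp only: split_paired_all prod.case)
  ultimately show ?thesis
    by simp
qed

lemma cross_le:
  assumes t: "0 < t"
  shows "cmod (cross x y) \<le> t * energy x y + variation x y / t"
proof -
  let ?X = "(\<phi> x + \<phi> y) * cmod (w x - w y)" and ?Y = "\<bar>\<phi> x - \<phi> y\<bar> * (cmod (w x) + cmod (w y))"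
  have nonneg: "0 \<le> b x y" "0 \<le> ?X"
    using cutoff_ge[of x] cutoff_ge[of y] by (simp_all add: edge_nonneg[OF graph])
  have "(\<phi> x)\<^sup>2 - (\<phi> y)\<^sup>2 = (\<phi> x - \<phi> y) * (\<phi> x + \<phi> y)"
    by (simp add: power2_eq_square algebra_simps)
  then have "cmod (cross x y) = b x y * (?X * (\<bar>\<phi> x - \<phi> y\<bar> * cmod (cnj (w x) + cnj (w y))))"
    using nonneg cutoff_ge[of x] cutoff_ge[of y] by (simp add: norm_mult abs_mult del: of_real_mult of_real_diff)
  also have "\<dots> \<le> b x y * (?X * ?Y)"
    using nonneg norm_triangle_ineq[of "cnj (w x)" "cnj (w y)"]
    by (intro mult_left_mono) auto
  also have "\<dots> \<le> b x y * (t / 2 * ?X\<^sup>2 + ?Y\<^sup>2 / (2 * t))"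
    using nonneg t by (intro mult_left_mono weighted_young)
  also have "\<dots> \<le> b x y * (t / 2 * (2 * (((\<phi> x)\<^sup>2 + (\<phi> y)\<^sup>2) * (cmod (w x - w y))\<^sup>2)) +
      2 * ((\<phi> x - \<phi> y)\<^sup>2 * ((cmod (w x))\<^sup>2 + (cmod (w y))\<^sup>2)) / (2 * t))"
  proof (intro mult_left_mono add_mono divide_right_mono nonneg)
    have sq: "(u + v)\<^sup>2 \<le> 2 * (u\<^sup>2 + v\<^sup>2)" for u v :: real
      using norm_add_square_le[of u v] by simp
    show "?X\<^sup>2 \<le> 2 * (((\<phi> x)\<^sup>2 + (\<phi> y)\<^sup>2) * (cmod (w x - w y))\<^sup>2)"
      using mult_right_mono[OF sq[of "\<phi> x" "\<phi> y"] zero_le_power2[of "cmod (w x - w y)"]]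
      by (simp only: power_mult_distrib mult.assoc)
    show "?Y\<^sup>2 \<le> 2 * ((\<phi> x - \<phi> y)\<^sup>2 * ((cmod (w x))\<^sup>2 + (cmod (w y))\<^sup>2))"
      using mult_left_mono[OF sq[of "cmod (w x)" "cmod (w y)"] zero_le_power2[of "\<phi> x - \<phi> y"]]
      by (simp only: power_mult_distrib power2_abs mult_ac)
  qed (use t in auto)
  also have "\<dots> = t * energy x y + variation x y / t"
    using t by (simp add: field_simps)
  finally show ?thesis .
qed

text \<open>
  The factor \<open>t\<close> distributes the cross term between energy and tail. The value \<open>1 / 2\<close> allows the
  energy to be absorbed in the real part of the identity, while a small value is chosen for the
  imaginary part.
\<close>
lemma total_cross_le:
  assumes t: "0 < t"
  shows "cmod (4 * total_flux - of_real total_energy) \<le> t * total_energy + 2 * \<kappa>\<^sup>2 * tail_mass / t"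
proof -
  obtain Q where Q: "((\<lambda>(x, y). variation x y) has_sum Q) UNIV" "Q \<le> 2 * \<kappa>\<^sup>2 * tail_mass"
    by (rule variation_has_sum)
  have "((\<lambda>(x, y). energy x y) has_sum total_energy) UNIV"
    using energy_summable by simp
  then have "((\<lambda>z. t * (\<lambda>(x, y). energy x y) z + inverse t * (\<lambda>(x, y). variation x y) z) has_sum
      t * total_energy + inverse t * Q) UNIV"
    by (intro has_sum_add has_sum_cmult_right Q)
  from norm_infsum_le[OF four_flux this]
  have "cmod (4 * total_flux - of_real total_energy) \<le> t * total_energy + inverse t * Q"
    using cross_le[OF t] by (fastforce simp: divide_inverse mult.commute)
  also have "\<dots> \<le> t * total_energy + inverse t * (2 * \<kappa>\<^sup>2 * tail_mass)"
    using t Q(2) by simp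
  finally show ?thesis
    by (simp add: divide_inverse mult_ac)
qed

lemma tail_mass_le: "tail_mass \<le> total_mass"
  by (intro infsum_mono mass_summable mass_on_summable) (simp add: mass_nonneg)

text \<open>
  Taking real parts, the energy is bounded by the mass, at the cost of the depth of the potential
  on the support of \<open>\<phi>\<close>, which is at most quadratic in \<open>R\<close>.
\<close>
lemma Caccioppoli: "total_energy \<le> 8 * (cmod \<zeta> + b1 + b2 * R\<^sup>2 + \<kappa>\<^sup>2) * total_mass"
proof -
  have "4 * Re total_flux - total_energy = Re (4 * total_flux - of_real total_energy)"
    by simp
  moreover have "\<bar>Re (4 * total_flux - of_real total_energy)\<bar> \<le> cmod (4 * total_flux - of_real total_energy)"
    by (rule abs_Re_le_cmod)
  ultimately have "total_energy \<le> 4 * Re total_flux + (1 / 2 * total_energy + 2 * \<kappa>\<^sup>2 * tail_mass / (1 / 2))"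
    using total_cross_le[of "1 / 2"] by linarith
  then have "total_energy \<le> 8 * Re total_flux + 8 * (\<kappa>\<^sup>2 * tail_mass)"
    by simp
  also have "\<dots> \<le> 8 * ((cmod \<zeta> + b1 + b2 * R\<^sup>2) * total_mass) + 8 * (\<kappa>\<^sup>2 * total_mass)"
    by (intro add_mono mult_left_mono Re_total_flux_le tail_mass_le) auto
  finally show ?thesis
    by (simp add: algebra_simps)
qed

lemma cutoff_mass_le:
  assumes t: "0 < t"
  shows "4 * \<bar>Im \<zeta>\<bar> * cutoff_mass \<le>
    t * (8 * (cmod \<zeta> + b1 + b2 * R\<^sup>2 + \<kappa>\<^sup>2) * total_mass) + 2 * \<kappa>\<^sup>2 * tail_mass / t"
proof -
  have "0 \<le> cutoff_mass"
    by (intro infsum_nonneg mult_nonneg_nonneg mass_nonneg) simp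
  then have "4 * \<bar>Im \<zeta>\<bar> * cutoff_mass = \<bar>4 * (Im \<zeta> * cutoff_mass)\<bar>"
    by (simp add: abs_mult)
  also have "4 * (Im \<zeta> * cutoff_mass) = Im (4 * total_flux - of_real total_energy)"
    unfolding Im_total_flux[symmetric] by simp
  also have "\<bar>Im (4 * total_flux - of_real total_energy)\<bar> \<le> cmod (4 * total_flux - of_real total_energy)"
    by (rule abs_Im_le_cmod)
  also have "\<dots> \<le> t * total_energy + 2 * \<kappa>\<^sup>2 * tail_mass / t"
    by (rule total_cross_le[OF t])
  also have "\<dots> \<le> t * (8 * (cmod \<zeta> + b1 + b2 * R\<^sup>2 + \<kappa>\<^sup>2) * total_mass) + 2 * \<kappa>\<^sup>2 * tail_mass / t"
    using t Caccioppoli by simp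
  finally show ?thesis .
qed

end

text \<open>
  With \<open>R = 2 n\<close> and \<open>\<kappa> = 1 / n\<close> the energy is at most of order \<open>n\<^sup>2\<close> and the variation at most
  \<open>2 / n\<^sup>2\<close> times the mass at distance at least \<open>n - s\<close> from \<open>p\<close>. The two powers of \<open>n\<close> cancel in
  the bound for the imaginary part, and what remains is small because the mass far out is small.
\<close>
lemma nonreal_eigenfunction_zero:
  assumes nonreal: "Im \<zeta> \<noteq> 0"
  shows "w = (\<lambda>x. 0)"
proof -
  define C where "C = 8 * (cmod \<zeta> + b1 + 4 * b2 + 1) * total_mass"
  have total_nonneg: "0 \<le> total_mass"
    by (intro infsum_nonneg mass_nonneg)
  have \<rho>_nonneg: "0 \<le> \<rho> x y" and \<rho>_sym: "\<rho> x y = \<rho> y x" and \<rho>_triangle: "\<rho> x y \<le> \<rho> x z + \<rho> z y" for x y z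
    using pseudo_metric unfolding pseudo_metric_def by blast+
  have bound: "4 * \<bar>Im \<zeta>\<bar> * (total_mass - \<delta>\<^sup>2) \<le> \<delta> * C + 2 * \<delta>" if \<delta>: "0 < \<delta>" for \<delta>
  proof -
    have "0 < \<delta>\<^sup>2"
      using \<delta> by simp
    from infsum_finite_approximation[OF mass_summable this] obtain S where
      S: "finite S" "dist (sum mass S) total_mass \<le> \<delta>\<^sup>2"
      by blast
    have S_mass: "total_mass - sum mass S \<le> \<delta>\<^sup>2"
      using S(2) unfolding dist_real_def by linarith
    \<comment> \<open>Any \<open>n \<ge> 1\<close> that exceeds \<open>s + \<rho> p x\<close> for all \<open>x\<close> in \<open>S\<close> would do.\<close>
    define n where "n = 1 + s + (\<Sum>x\<in>S. \<rho> p x)"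
    have n: "1 \<le> n"
      using s_nonneg \<rho>_nonneg by (simp add: n_def sum_nonneg)
    have S_near: "\<rho> p x < n - s" if "x \<in> S" for x
      using member_le_sum[of x S "\<rho> p"] that S(1) \<rho>_nonneg by (simp add: n_def)
    define \<phi> where "\<phi> x = max 0 (min 1 (2 - \<rho> p x / n))" for x
    define N where "N = {x. n - s \<le> \<rho> p x}"
    have \<phi>_one: "\<phi> x = 1" if "\<rho> p x \<le> n" for x
      using that n by (simp add: \<phi>_def)
    \<comment> \<open>The weight \<open>t = \<delta> / n\<^sup>2\<close> removes the growth of the energy. The tail, which is at most \<open>\<delta>\<^sup>2\<close>,
      ends up divided by \<open>\<delta>\<close>.\<close>
    have main: "4 * \<bar>Im \<zeta>\<bar> * (\<Sum>\<^sub>\<infinity>x. (\<phi> x)\<^sup>2 * mass x) \<le>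
      \<delta> / n\<^sup>2 * (8 * (cmod \<zeta> + b1 + b2 * (2 * n)\<^sup>2 + (1 / n)\<^sup>2) * total_mass) +
      2 * (1 / n)\<^sup>2 * (\<Sum>\<^sub>\<infinity>x. if x \<in> N then mass x else 0) / (\<delta> / n\<^sup>2)"
    proof (rule cutoff_mass_le)
      show "0 \<le> \<phi> x" "\<phi> x \<le> 1" for x
        by (auto simp: \<phi>_def)
      show "\<bar>\<phi> x - \<phi> y\<bar> \<le> 1 / n * \<rho> x y" for x y
      proof -
        have "\<bar>\<phi> x - \<phi> y\<bar> \<le> \<bar>(2 - \<rho> p x / n) - (2 - \<rho> p y / n)\<bar>"
          unfolding \<phi>_def by (rule clamp_Lipschitz)
        also have "\<dots> = \<bar>\<rho> p y - \<rho> p x\<bar> / n"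
          using n by (simp add: diff_divide_distrib[symmetric])
        also have "\<bar>\<rho> p y - \<rho> p x\<bar> \<le> \<rho> x y"
          using \<rho>_triangle[of p y x] \<rho>_triangle[of p x y] \<rho>_sym[of x y] by linarith
        finally show ?thesis
          using n by (simp add: divide_right_mono)
      qed
      show "0 \<le> 2 * n" "0 < \<delta> / n\<^sup>2"
        using n \<delta> by auto
      show "\<rho> p x \<le> 2 * n" if "\<phi> x \<noteq> 0" for x
        using that n by (auto simp: \<phi>_def max_def min_def field_simps split: if_splits)
      show "x \<in> N" if "0 < b x y" "\<phi> x \<noteq> \<phi> y" for x y
      proof (rule ccontr)
        assume "x \<notin> N"
        then have "\<rho> p x \<le> n" "\<rho> p y \<le> n"
          using distance_step[OF that(1)] s_nonneg by (auto simp: N_def)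
        then show False
          using \<phi>_one that(2) by simp
      qed
    qed
    have "total_mass - \<delta>\<^sup>2 \<le> (\<Sum>x\<in>S. (\<phi> x)\<^sup>2 * mass x)"
    proof -
      have "(\<phi> x)\<^sup>2 * mass x = mass x" if "x \<in> S" for x
        using \<phi>_one[of x] S_near[OF that] s_nonneg by simp
      then have "(\<Sum>x\<in>S. (\<phi> x)\<^sup>2 * mass x) = sum mass S"
        by (intro sum.cong refl)
      then show ?thesis
        using S_mass by linarith
    qed
    also have "\<dots> \<le> (\<Sum>\<^sub>\<infinity>x. (\<phi> x)\<^sup>2 * mass x)"
    proof (rule finite_sum_le_infsum)
      show "(\<lambda>x. (\<phi> x)\<^sup>2 * mass x) summable_on UNIV"
        by (rule cutoff_mass_summable) (auto simp: \<phi>_def)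
    qed (auto intro!: mult_nonneg_nonneg mass_nonneg S)
    finally have "4 * \<bar>Im \<zeta>\<bar> * (total_mass - \<delta>\<^sup>2) \<le> 4 * \<bar>Im \<zeta>\<bar> * (\<Sum>\<^sub>\<infinity>x. (\<phi> x)\<^sup>2 * mass x)"
      by (intro mult_left_mono) auto
    also note main
    also have "\<delta> / n\<^sup>2 * (8 * (cmod \<zeta> + b1 + b2 * (2 * n)\<^sup>2 + (1 / n)\<^sup>2) * total_mass) \<le> \<delta> * C"
    proof -
      have n2: "1 \<le> n\<^sup>2" "0 < n\<^sup>2"
        using n by (auto intro: one_le_power)
      have "(1 / n)\<^sup>2 \<le> 1"
        using n by (intro power_le_one) auto
      then have "cmod \<zeta> + b1 + b2 * (2 * n)\<^sup>2 + (1 / n)\<^sup>2 \<le> (cmod \<zeta> + b1 + 1) + 4 * b2 * n\<^sup>2"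
        by (simp add: power_mult_distrib)
      also have "\<dots> \<le> (cmod \<zeta> + b1 + 1) * n\<^sup>2 + 4 * b2 * n\<^sup>2"
        using mult_left_mono[OF n2(1), of "cmod \<zeta> + b1 + 1"] b1 by simp
      also have "\<dots> = n\<^sup>2 * (cmod \<zeta> + b1 + 4 * b2 + 1)"
        by (simp add: algebra_simps)
      finally have "\<delta> / n\<^sup>2 * (8 * (cmod \<zeta> + b1 + b2 * (2 * n)\<^sup>2 + (1 / n)\<^sup>2) * total_mass) \<le>
          \<delta> / n\<^sup>2 * (8 * (n\<^sup>2 * (cmod \<zeta> + b1 + 4 * b2 + 1)) * total_mass)"
        using \<delta> n total_nonneg by (intro mult_left_mono mult_right_mono) auto
      also have "\<dots> = \<delta> * C"
        using n by (simp add: C_def)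
      finally show ?thesis .
    qed
    also have "2 * (1 / n)\<^sup>2 * (\<Sum>\<^sub>\<infinity>x. if x \<in> N then mass x else 0) / (\<delta> / n\<^sup>2) \<le> 2 * \<delta>"
    proof -
      have "(\<Sum>\<^sub>\<infinity>x. if x \<in> N then mass x else 0) \<le> total_mass + (\<Sum>x\<in>S. - mass x)"
      proof (rule has_sum_mono)
        show "((\<lambda>x. if x \<in> N then mass x else 0) has_sum (\<Sum>\<^sub>\<infinity>x. if x \<in> N then mass x else 0)) UNIV"
          by (intro has_sum_infsum mass_on_summable)
        show "((\<lambda>x. mass x + (if x \<in> S then - mass x else 0)) has_sum total_mass + (\<Sum>x\<in>S. - mass x)) UNIV"
          using S(1) by (intro has_sum_add has_sum_infsum mass_summable has_sum_finite_neutralI) auto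
        show "(if x \<in> N then mass x else 0) \<le> mass x + (if x \<in> S then - mass x else 0)" for x
          using S_near[of x] mass_nonneg[of x] by (auto simp: N_def)
      qed
      then have "(\<Sum>\<^sub>\<infinity>x. if x \<in> N then mass x else 0) \<le> \<delta>\<^sup>2"
        using S_mass by (simp add: sum_negf)
      then have "2 * (\<Sum>\<^sub>\<infinity>x. if x \<in> N then mass x else 0) / \<delta> \<le> 2 * \<delta>\<^sup>2 / \<delta>"
        using \<delta> by (intro divide_right_mono) auto
      then show ?thesis
        using \<delta> n by (simp add: power2_eq_square)
    qed
    finally show ?thesis
      by simp
  qed
  have "4 * \<bar>Im \<zeta>\<bar> * total_mass \<le> 0"
  proof (rule LIMSEQ_le)
    have lim: "(\<lambda>n. inverse (real (Suc n))) \<longlonglongrightarrow> 0"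
      by (rule LIMSEQ_inverse_real_of_nat)
    show "(\<lambda>n. 4 * \<bar>Im \<zeta>\<bar> * (total_mass - (inverse (real (Suc n)))\<^sup>2)) \<longlonglongrightarrow> 4 * \<bar>Im \<zeta>\<bar> * total_mass"
      using tendsto_mult_left[OF tendsto_diff[OF tendsto_const tendsto_power[OF lim]], of "4 * \<bar>Im \<zeta>\<bar>" total_mass 2]
      by simp
    show "(\<lambda>n. inverse (real (Suc n)) * C + 2 * inverse (real (Suc n))) \<longlonglongrightarrow> 0"
      using tendsto_add[OF tendsto_mult_right[OF lim, of C] tendsto_mult_left[OF lim, of 2]] by simp
    show "\<exists>N. \<forall>n\<ge>N. 4 * \<bar>Im \<zeta>\<bar> * (total_mass - (inverse (real (Suc n)))\<^sup>2) \<le>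
        inverse (real (Suc n)) * C + 2 * inverse (real (Suc n))"
      by (intro exI allI impI bound) simp
  qed
  then have "total_mass = 0"
    using nonreal total_nonneg by (simp add: mult_le_0_iff)
  then show ?thesis
    by (intro ell2_norm_eq_0[OF weight_pos w_ell2]) (simp add: ell2_norm_def)
qed

end

section \<open>Essential self-adjointness\<close>

theorem corollary2p2:
  fixes b :: "'v::countable \<Rightarrow> 'v \<Rightarrow> real"
    and \<mu> V :: "'v \<Rightarrow> real"
    and \<rho> :: "'v \<Rightarrow> 'v \<Rightarrow> real"
    and p :: 'v
    and b1 b2 :: real
  assumes "weighted_graph b"
    and "connected_graph b"
    and "\<And>x. \<mu> x > 0"
    and FC: "finiteness_condition b \<mu>"
    and "pseudo_metric \<rho>"
    and "intrinsic b \<mu> \<rho>"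
    and B: "\<And>q r. r \<ge> 0 \<Longrightarrow> bounded (weighted_degree b \<mu> ` pm_ball \<rho> q r)"
    and J: "jump_size b \<rho> < \<infinity>"
    and "b1 \<ge> 0"
    and "b2 \<ge> 0"
    and "\<And>x. V x \<ge> - b1 - b2 * (\<rho> p x)\<^sup>2"
  shows "essentially_self_adjoint \<mu> (restrict_operator (schroedinger b \<mu> V) finitely_supported)"
proof -
  let ?L = "restrict_operator (schroedinger b \<mu> V) finitely_supported"
  obtain s where s: "0 \<le> s" "\<And>x y. adjacent b x y \<Longrightarrow> \<rho> x y \<le> s"
    using jump_size_finiteD[OF J] by blast
  have zero: "w = (\<lambda>x. 0)"
    if w: "(w, \<lambda>x. \<zeta> * w x) \<in> operator_adjoint \<mu> ?L" and \<zeta>: "Im \<zeta> \<noteq> 0" for w \<zeta>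
  proof (rule nonreal_eigenfunction_zero)
    show w_ell2: "w \<in> ell2 \<mu>"
      using w by (simp add: operator_adjoint_def)
    then show "w \<in> formal_domain b"
      using ell2_subset_formal_domain[OF assms(1,3) FC] by blast
    show "formal_schroedinger b \<mu> V w x = \<zeta> * w x" for x
      using adjoint_acts_formally[OF assms(1,3) FC w] by (simp add: fun_eq_iff)
  qed (fact assms B s \<zeta>)+
  show ?thesis
  proof (rule basic_criterion_essential_self_adjointness)
    show "ell2_operator \<mu> ?L" "densely_defined \<mu> ?L" "symmetric_operator \<mu> ?L"
      by (rule minimal_operator minimal_operator_dense minimal_operator_symmetric; fact assms)+
    show "w = (\<lambda>x. 0)" if "(w, \<lambda>x. \<i> * w x) \<in> operator_adjoint \<mu> ?L" for w
      using zero[OF that] by simp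
    show "w = (\<lambda>x. 0)" if "(w, \<lambda>x. - \<i> * w x) \<in> operator_adjoint \<mu> ?L" for w
      using zero[OF that] by simp
  qed (fact assms)
qed

end
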